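(* Let $(X,\mu)$ be a probability space, $G$ a countable amenable group, $(F_n)_n$ a left Følner sequence of subsets of $G$, $d\geq 1$, and let $T_1,\ldots,T_d : G\curvearrowright (X,\mu)$ be commuting $\mu$-preserving actions of $G$. For $f_1,\ldots,f_d\in L^\infty(\mu)$ put $$\Lambda_n(f_1,\ldots,f_d) := \frac{1}{|F_n|}\sum_{g\in F_n}\prod_{i=1}^d \big(f_i\circ T_1^gT_2^g\cdots T_i^g\big).$$ Then for all $f_1,\ldots,f_d\in L^\infty(\mu)$ the functional averages $\Lambda_n(f_1,\ldots,f_d)$ converge in the norm of $L^2(\mu)$ as $n\to\infty$.
   Context: The actions $T_1,\ldots,T_d$ commute means: whenever $i\neq j$, $T_i^gT_j^h=T_j^hT_i^g$ for all $g,h\in G$. Here $T_i^{gh}=T_i^gT_i^h$. A left Følner sequence is a sequence of finite non-empty subsets $F_n\subseteq G$ with $|gF_n\triangle F_n|/|F_n|\to 0$ for every $g\in G$. *)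

theory Defs
  imports "HOL-Probability.Probability" "HOL-Algebra.Group_Action"
begin

definition amenable :: "('g, 'r) monoid_scheme \<Rightarrow> bool" where
  "amenable G \<longleftrightarrow> group G \<and>
    (\<exists>m :: 'g set \<Rightarrow> real.
       (\<forall>A. A \<subseteq> carrier G \<longrightarrow> 0 \<le> m A) \<and>
       m (carrier G) = 1 \<and>
       (\<forall>A B. A \<subseteq> carrier G \<longrightarrow> B \<subseteq> carrier G \<longrightarrow> A \<inter> B = {} \<longrightarrow> m (A \<union> B) = m A + m B) \<and>
       (\<forall>g\<in>carrier G. \<forall>A. A \<subseteq> carrier G \<longrightarrow> m (g <#\<^bsub>G\<^esub> A) = m A))"

definition left_Folner_sequence :: "('g, 'r) monoid_scheme \<Rightarrow> (nat \<Rightarrow> 'g set) \<Rightarrow> bool" where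
  "left_Folner_sequence G F \<longleftrightarrow>
    (\<forall>n. F n \<subseteq> carrier G \<and> finite (F n) \<and> F n \<noteq> {}) \<and>
    (\<forall>g\<in>carrier G.
       (\<lambda>n. real (card (sym_diff (g <#\<^bsub>G\<^esub> F n) (F n))) / real (card (F n))) \<longlonglongrightarrow> 0)"

text \<open>The library's \<open>group_action\<close> is a homomorphism into the group of bijections of the underlying
  set under composition, so it gives \<open>T (g \<otimes> h) x = T g (T h x)\<close> for \<open>x\<close> in the space. Its
  elements are extensional, i.e. normalised to \<open>undefined\<close> outside the space; this is no
  restriction on the action itself.\<close>

definition mp_action ::
    "('g, 'r) monoid_scheme \<Rightarrow> 'a measure \<Rightarrow> ('g \<Rightarrow> 'a \<Rightarrow> 'a) \<Rightarrow> bool" where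
  "mp_action G M T \<longleftrightarrow>
    group_action G (space M) T \<and>
    (\<forall>g\<in>carrier G. T g \<in> measurable M M \<and> distr M M (T g) = M)"

definition commuting_actions ::
    "('g, 'r) monoid_scheme \<Rightarrow> 'a measure \<Rightarrow> nat \<Rightarrow> (nat \<Rightarrow> 'g \<Rightarrow> 'a \<Rightarrow> 'a) \<Rightarrow> bool" where
  "commuting_actions G M d T \<longleftrightarrow>
    (\<forall>i\<in>{1..d}. \<forall>j\<in>{1..d}. i \<noteq> j \<longrightarrow>
       (\<forall>g\<in>carrier G. \<forall>h\<in>carrier G. \<forall>x\<in>space M.
          T i g (T j h x) = T j h (T i g x)))"

text \<open>\<open>comp_upto T g i\<close> is \<open>T 1 g \<circ> T 2 g \<circ> \<dots> \<circ> T i g\<close>; the value \<open>T 0\<close> is not used.\<close>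

primrec comp_upto :: "(nat \<Rightarrow> 'g \<Rightarrow> 'a \<Rightarrow> 'a) \<Rightarrow> 'g \<Rightarrow> nat \<Rightarrow> 'a \<Rightarrow> 'a" where
  "comp_upto T g 0 = id"
| "comp_upto T g (Suc i) = comp_upto T g i \<circ> T (Suc i) g"

definition functional_average ::
    "(nat \<Rightarrow> 'g set) \<Rightarrow> nat \<Rightarrow> (nat \<Rightarrow> 'g \<Rightarrow> 'a \<Rightarrow> 'a) \<Rightarrow> (nat \<Rightarrow> 'a \<Rightarrow> complex)
      \<Rightarrow> nat \<Rightarrow> 'a \<Rightarrow> complex" where
  "functional_average F d T f n x =
    (1 / of_nat (card (F n))) * (\<Sum>g\<in>F n. \<Prod>i=1..d. (f i \<circ> comp_upto T g i) x)"

text \<open>Elements of \<open>L\<^sup>\<infinity>\<close> and \<open>L\<^sup>2\<close> are represented by functions rather than by classes of functions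
  modulo almost everywhere equality.\<close>

definition Linf_space :: "'a measure \<Rightarrow> ('a \<Rightarrow> complex) set" where
  "Linf_space M = {f \<in> borel_measurable M. \<exists>C::real. AE x in M. norm (f x) \<le> C}"

definition L2_space :: "'a measure \<Rightarrow> ('a \<Rightarrow> complex) set" where
  "L2_space M = {f \<in> borel_measurable M. integrable M (\<lambda>x. (norm (f x))\<^sup>2)}"

definition L2_norm :: "'a measure \<Rightarrow> ('a \<Rightarrow> complex) \<Rightarrow> real" where
  "L2_norm M f = sqrt (\<integral>x. (norm (f x))\<^sup>2 \<partial>M)"

text \<open>Membership of the terms in \<open>L\<^sup>2\<close> is part of the definition, since \<open>L2_norm\<close> is
  only meaningful on \<open>L2_space\<close>.\<close>

definition converges_in_L2 :: "'a measure \<Rightarrow> (nat \<Rightarrow> 'a \<Rightarrow> complex) \<Rightarrow> bool" where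
  "converges_in_L2 M u \<longleftrightarrow>
    (\<forall>n. u n \<in> L2_space M) \<and>
    (\<exists>v\<in>L2_space M. (\<lambda>n. L2_norm M (\<lambda>x. u n x - v x)) \<longlonglongrightarrow> 0)"

end

theory Submission
  imports Defs
begin

text \<open>The idea is Walsh's, in quantitative form. The maps \<open>S k g = T 1 g \<circ> \<dots> \<circ> T k g\<close> are again
  actions of \<open>G\<close>, and for \<open>k < D\<close> the map \<open>S k m \<circ> S D (inv m)\<close> commutes with \<open>S k l\<close>. If an average
  with last function \<open>u\<close> is large in \<open>L\<^sup>1\<close>, then pairing it with its sign shows that \<open>u\<close> correlates
  with a dual function \<open>\<sigma>\<close>, an average over \<open>m \<in> F n'\<close> of products of functions composed with
  \<open>S k m \<circ> S D (inv m)\<close>. Subtracting a multiple of \<open>\<sigma>\<close> from \<open>u\<close> lowers its energy by a fixed amount, so after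
  boundedly many steps the remaining average is small. Conversely, if \<open>F n'\<close> is nearly invariant under \<open>l\<close>,
  then \<open>\<sigma> \<circ> S D l\<close> is nearly an average over \<open>m\<close> of products of functions composed with \<open>S k l\<close>
  for \<open>k < D\<close>. Hence averages whose last function is dual reduce to averages with one function fewer. To make the
  induction on the number of functions work, convergence is replaced by metastability with bounds uniform over
  all tuples of functions bounded by 1.\<close>

lemma norm_sum_diff_le_card_sym_diff:
  fixes f :: "'b \<Rightarrow> 'c::real_normed_vector"
  assumes "finite A" "finite B" "\<And>x. x \<in> A \<union> B \<Longrightarrow> norm (f x) \<le> 1"
  shows "norm (sum f A - sum f B) \<le> real (card (sym_diff B A))"
proof -
  have "sum f A = sum f (A - B) + sum f (A \<inter> B)" "sum f B = sum f (B - A) + sum f (A \<inter> B)"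
    using assms(1,2) by (metis add.commute sum.Int_Diff, metis Int_commute add.commute sum.Int_Diff)
  then have "norm (sum f A - sum f B) \<le> norm (sum f (A - B)) + norm (sum f (B - A))"
    by (simp add: norm_triangle_ineq4)
  also have "\<dots> \<le> real (card (A - B)) + real (card (B - A))"
    using assms(3) by (intro add_mono order_trans[OF norm_sum] order_trans[OF sum_bounded_above[of _ _ 1]]) auto
  also have "\<dots> = real (card (sym_diff B A))"
    using assms(1,2) by (subst card_Un_disjoint) auto
  finally show ?thesis .
qed

section \<open>Towers of measure-preserving actions and bounded functions\<close>

text \<open>The induction needs only the partial products \<open>S k\<close>, not the single
  actions. If \<open>S k\<close> is the product of commuting actions \<open>T 1\<close>, ...,
  \<open>T k\<close>, then \<open>S i m\<close> after \<open>S k (inv m)\<close> collapses to the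
  product of the \<open>T j (inv m)\<close> with \<open>i < j \<le> k\<close>, which is why it
  commutes with \<open>S i l\<close>.\<close>

locale action_tower = prob_space M + group G
  for M :: "'a measure" and G :: "('g, 'r) monoid_scheme" (structure) +
  fixes F :: "nat \<Rightarrow> 'g set" and S :: "nat \<Rightarrow> 'g \<Rightarrow> 'a \<Rightarrow> 'a" and d :: nat
  assumes Folner: "left_Folner_sequence G F"
    and S_measurable: "\<lbrakk>k \<in> {1..d}; g \<in> carrier G\<rbrakk> \<Longrightarrow> S k g \<in> measurable M M"
    and S_distr: "\<lbrakk>k \<in> {1..d}; g \<in> carrier G\<rbrakk> \<Longrightarrow> distr M M (S k g) = M"
    and S_mult: "\<lbrakk>k \<in> {1..d}; g \<in> carrier G; h \<in> carrier G; x \<in> space M\<rbrakk>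
      \<Longrightarrow> S k (g \<otimes> h) x = S k g (S k h x)"
    and S_one: "\<lbrakk>k \<in> {1..d}; x \<in> space M\<rbrakk> \<Longrightarrow> S k \<one> x = x"
    and S_commute: "\<lbrakk>1 \<le> i; i < k; k \<le> d; l \<in> carrier G; m \<in> carrier G; x \<in> space M\<rbrakk>
      \<Longrightarrow> S i l (S i m (S k (inv m) x)) = S i m (S k (inv m) (S i l x))"
begin

lemma F_carrier: "g \<in> F n \<Longrightarrow> g \<in> carrier G"
  and F_subset: "F n \<subseteq> carrier G"
  and F_finite [simp]: "finite (F n)"
  and F_nonempty [simp]: "F n \<noteq> {}"
  using Folner by (auto simp: left_Folner_sequence_def)

lemma card_F_pos: "0 < card (F n)"
  by (simp add: card_gt_0_iff)

lemma S_space: "\<lbrakk>k \<in> {1..d}; g \<in> carrier G; x \<in> space M\<rbrakk> \<Longrightarrow> S k g x \<in> space M"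
  using S_measurable measurable_space by metis

lemma S_inv: "\<lbrakk>k \<in> {1..d}; g \<in> carrier G; x \<in> space M\<rbrakk> \<Longrightarrow> S k (inv g) (S k g x) = x"
  using S_mult[of k "inv g" g x] S_one by simp

text \<open>The bound holds everywhere on the space, not just almost everywhere, so that
  compositions and pointwise estimates involve no null sets. General \<open>Linf_space\<close>
  functions are brought into this form by truncation in the final proof.\<close>

definition bounded_by :: "real \<Rightarrow> ('a \<Rightarrow> complex) \<Rightarrow> bool" where
  "bounded_by C f \<longleftrightarrow> f \<in> borel_measurable M \<and> (\<forall>x\<in>space M. norm (f x) \<le> C)"

lemma bounded_byD: "bounded_by C f \<Longrightarrow> f \<in> borel_measurable M"
  "bounded_by C f \<Longrightarrow> x \<in> space M \<Longrightarrow> norm (f x) \<le> C"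
  by (auto simp: bounded_by_def)

lemma bounded_by_integrable: "bounded_by C f \<Longrightarrow> integrable M f"
  unfolding bounded_by_def by (intro integrable_const_bound[where B = C]) auto

lemma bounded_by_S:
  assumes "bounded_by C f" "k \<in> {1..d}" "g \<in> carrier G"
  shows "bounded_by C (\<lambda>x. f (S k g x))"
  unfolding bounded_by_def
proof
  show "(\<lambda>x. f (S k g x)) \<in> borel_measurable M"
    using measurable_compose[OF S_measurable[OF assms(2,3)]] assms(1) by (auto simp: bounded_by_def)
qed (use assms S_space in \<open>auto simp: bounded_by_def\<close>)

lemma integral_S:
  fixes f :: "'a \<Rightarrow> 'c::{banach, second_countable_topology}"
  assumes "f \<in> borel_measurable M" "k \<in> {1..d}" "g \<in> carrier G"
  shows "(\<integral>x. f (S k g x) \<partial>M) = (\<integral>x. f x \<partial>M)"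
  using integral_distr[OF S_measurable[OF assms(2,3)] assms(1)] S_distr[OF assms(2,3)] by simp

lemma bounded_by_mult: "bounded_by C f \<Longrightarrow> bounded_by C' g \<Longrightarrow> bounded_by (C * C') (\<lambda>x. f x * g x)"
  unfolding bounded_by_def
  by (auto simp: norm_mult intro!: borel_measurable_times mult_mono intro: order_trans[OF norm_ge_zero])

lemma bounded_by_mult1: "bounded_by 1 f \<Longrightarrow> bounded_by C' g \<Longrightarrow> bounded_by C' (\<lambda>x. f x * g x)"
  using bounded_by_mult[of 1 f C' g] by simp

lemma bounded_by_diff: "bounded_by C f \<Longrightarrow> bounded_by C' g \<Longrightarrow> bounded_by (C + C') (\<lambda>x. f x - g x)"
  unfolding bounded_by_def
  by (auto intro!: order_trans[OF norm_triangle_ineq4] add_mono)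

lemma bounded_by_sum:
  "(\<And>i. i \<in> I \<Longrightarrow> bounded_by (C i) (f i)) \<Longrightarrow> bounded_by (sum C I) (\<lambda>x. \<Sum>i\<in>I. f i x)"
  unfolding bounded_by_def by (auto intro!: sum_norm_le borel_measurable_sum)

lemma bounded_by_prod1:
  "(\<And>i. i \<in> I \<Longrightarrow> bounded_by 1 (f i)) \<Longrightarrow> bounded_by 1 (\<lambda>x. \<Prod>i\<in>I. f i x)"
  unfolding bounded_by_def by (auto simp flip: prod_norm intro!: prod_le_1 borel_measurable_prod)

lemma bounded_by_cnj: "bounded_by C f \<Longrightarrow> bounded_by C (\<lambda>x. cnj (f x))"
  using measurable_compose[OF _ borel_measurable_continuous_onI[of cnj], of f M]
  unfolding bounded_by_def by (auto simp: continuous_on_cnj)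

lemma bounded_by_sgn: "f \<in> borel_measurable M \<Longrightarrow> bounded_by 1 (\<lambda>x. sgn (f x))"
  unfolding bounded_by_def sgn_div_norm by (auto simp: divide_simps)

section \<open>Averaging over a single Folner set\<close>

definition favg :: "nat \<Rightarrow> ('g \<Rightarrow> complex) \<Rightarrow> complex" where
  "favg n f = (1 / of_nat (card (F n))) * (\<Sum>g\<in>F n. f g)"

lemma favg_cong: "(\<And>g. g \<in> F n \<Longrightarrow> f g = f' g) \<Longrightarrow> favg n f = favg n f'"
  unfolding favg_def by (simp cong: sum.cong)

lemma favg_diff: "favg n f - favg n f' = favg n (\<lambda>g. f g - f' g)"
  unfolding favg_def by (simp add: sum_subtractf algebra_simps)

lemma favg_mult: "c * favg n f = favg n (\<lambda>g. c * f g)"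
  unfolding favg_def by (simp flip: sum_distrib_left)

lemma favg_sum: "(\<Sum>i\<in>I. favg n (f i)) = favg n (\<lambda>g. \<Sum>i\<in>I. f i g)"
  unfolding favg_def by (simp add: sum_distrib_left sum.swap[of _ I])

lemma favg_swap: "favg n (\<lambda>g. favg n' (\<lambda>h. f g h)) = favg n' (\<lambda>h. favg n (\<lambda>g. f g h))"
  unfolding favg_def sum_distrib_left by (subst sum.swap) (simp add: mult.commute)

lemma norm_favg: "norm (favg n f) \<le> (1 / card (F n)) * (\<Sum>g\<in>F n. norm (f g))"
  unfolding favg_def by (simp add: norm_mult norm_divide norm_sum divide_right_mono)

lemma norm_favg_le:
  assumes "\<And>g. g \<in> F n \<Longrightarrow> norm (f g) \<le> C"
  shows "norm (favg n f) \<le> C"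
proof -
  have "(\<Sum>g\<in>F n. norm (f g)) \<le> card (F n) * C"
    using sum_bounded_above[of "F n" "\<lambda>g. norm (f g)" C] assms by simp
  then have "(1 / card (F n)) * (\<Sum>g\<in>F n. norm (f g)) \<le> C"
    using card_F_pos[of n] by (simp add: divide_le_eq mult.commute)
  with norm_favg show ?thesis by (rule order_trans)
qed

lemma cnj_favg: "cnj (favg n f) = favg n (\<lambda>g. cnj (f g))"
  unfolding favg_def by simp

lemma bounded_by_favg:
  "(\<And>g. g \<in> F n \<Longrightarrow> bounded_by C (f g)) \<Longrightarrow> bounded_by C (\<lambda>x. favg n (\<lambda>g. f g x))"
  unfolding bounded_by_def
  by (intro conjI ballI norm_favg_le)
    (unfold favg_def, intro borel_measurable_times borel_measurable_sum, auto)

lemma integral_favg: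
  assumes "\<And>g. g \<in> F n \<Longrightarrow> integrable M (f g)"
  shows "(\<integral>x. favg n (\<lambda>g. f g x) \<partial>M) = favg n (\<lambda>g. \<integral>x. f g x \<partial>M)"
  unfolding favg_def using assms by (simp add: integral_sum)

section \<open>Multiple averages, dual functions and adjointness\<close>

definition avg :: "nat \<Rightarrow> (nat \<Rightarrow> 'a \<Rightarrow> complex) \<Rightarrow> nat \<Rightarrow> 'a \<Rightarrow> complex" where
  "avg e f n x = favg n (\<lambda>g. \<Prod>k=1..e. f k (S k g x))"

text \<open>The last function is singled out because the average is linear in it and it is the one
  to be decomposed; its bound may exceed 1, while the other functions keep bound 1.\<close>

definition avg_last :: "nat \<Rightarrow> (nat \<Rightarrow> 'a \<Rightarrow> complex) \<Rightarrow> ('a \<Rightarrow> complex) \<Rightarrow> nat \<Rightarrow> 'a \<Rightarrow> complex" where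
  "avg_last e f u n x = favg n (\<lambda>g. (\<Prod>k=1..e. f k (S k g x)) * u (S (Suc e) g x))"

text \<open>\<open>dual\<close> is the adjoint of \<open>avg_last\<close> with respect to the last function \<open>u\<close>.\<close>

definition dual :: "nat \<Rightarrow> ('a \<Rightarrow> complex) \<Rightarrow> (nat \<Rightarrow> 'a \<Rightarrow> complex) \<Rightarrow> nat \<Rightarrow> 'a \<Rightarrow> complex" where
  "dual e b0 b n x = favg n (\<lambda>m. b0 (S (Suc e) (inv m) x) *
     (\<Prod>k=1..e. b k (S k m (S (Suc e) (inv m) x))))"

lemma avg_Suc: "avg (Suc e) f n = avg_last e f (f (Suc e)) n"
  unfolding avg_def avg_last_def by auto

lemma bounded_by_avg:
  assumes "e \<le> d" "\<And>k. k \<in> {1..e} \<Longrightarrow> bounded_by 1 (f k)"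
  shows "bounded_by 1 (avg e f n)"
  unfolding avg_def using assms
  by (intro bounded_by_favg bounded_by_prod1 bounded_by_S) (auto simp: F_carrier)

lemma bounded_by_avg_last:
  assumes "Suc e \<le> d" "\<And>k. k \<in> {1..e} \<Longrightarrow> bounded_by 1 (f k)" "bounded_by C u"
  shows "bounded_by C (avg_last e f u n)"
  unfolding avg_last_def using assms
  by (intro bounded_by_favg bounded_by_mult1 bounded_by_prod1 bounded_by_S) (auto simp: F_carrier)

lemma bounded_by_dual:
  assumes "Suc e \<le> d" "\<And>k. k \<in> {1..e} \<Longrightarrow> bounded_by 1 (b k)" "bounded_by 1 b0"
  shows "bounded_by 1 (dual e b0 b n)"
  unfolding dual_def using assms
  by (intro bounded_by_favg bounded_by_mult1 bounded_by_prod1 bounded_by_S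
      bounded_by_S[where f = "\<lambda>x. b _ (S _ _ x)"]) (auto simp: F_carrier)

lemma cnj_dual: "cnj (dual e b0 b n x) = dual e (\<lambda>x. cnj (b0 x)) (\<lambda>k x. cnj (b k x)) n x"
  unfolding dual_def by (simp add: cnj_favg)

lemma avg_last_diff:
  "avg_last e f (\<lambda>x. u x - v x) n x = avg_last e f u n x - avg_last e f v n x"
  unfolding avg_last_def by (simp add: favg_diff algebra_simps)

lemma avg_last_sum:
  "avg_last e f (\<lambda>x. \<Sum>s\<in>I. c s * v s x) n x = (\<Sum>s\<in>I. c s * avg_last e f (v s) n x)"
  unfolding avg_last_def by (simp add: favg_sum favg_mult sum_distrib_left algebra_simps)

text \<open>For each \<open>g\<close>, substituting \<open>S (Suc e) g x\<close> for
  \<open>x\<close> preserves the integral and cancels \<open>S (Suc e) (inv g)\<close>; averaging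
  over \<open>g\<close> gives the adjointness.\<close>

lemma integral_avg_last_mult:
  assumes e: "Suc e \<le> d" and f: "\<And>k. k \<in> {1..e} \<Longrightarrow> bounded_by 1 (f k)"
    and u: "bounded_by C u" and b: "bounded_by 1 b"
  shows "(\<integral>x. b x * avg_last e f u n x \<partial>M) = (\<integral>x. u x * dual e b f n x \<partial>M)"
proof -
  let ?D = "Suc e"
  have D: "?D \<in> {1..d}" using e by simp
  have b1: "bounded_by C (\<lambda>x. b x * ((\<Prod>k=1..e. f k (S k g x)) * u (S ?D g x)))" if "g \<in> F n" for g
    using assms that by (intro bounded_by_mult1 bounded_by_prod1 bounded_by_S) (auto simp: F_carrier)
  have b2: "bounded_by (C * 1) (\<lambda>x. u x * (b (S ?D (inv g) x) * (\<Prod>k=1..e. f k (S k g (S ?D (inv g) x)))))"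
    if "g \<in> F n" for g
    using assms that
    by (intro bounded_by_mult bounded_by_mult1 bounded_by_prod1 bounded_by_S
      bounded_by_S[where f = "\<lambda>x. f _ (S _ _ x)"]) (auto simp: F_carrier)
  have eq: "(\<integral>x. b x * ((\<Prod>k=1..e. f k (S k g x)) * u (S ?D g x)) \<partial>M) =
      (\<integral>x. u x * (b (S ?D (inv g) x) * (\<Prod>k=1..e. f k (S k g (S ?D (inv g) x)))) \<partial>M)"
    if g: "g \<in> F n" for g
  proof -
    have gc: "g \<in> carrier G" using g F_carrier by blast
    have "(\<integral>x. u x * (b (S ?D (inv g) x) * (\<Prod>k=1..e. f k (S k g (S ?D (inv g) x)))) \<partial>M) =
      (\<integral>x. u (S ?D g x) * (b (S ?D (inv g) (S ?D g x)) *
        (\<Prod>k=1..e. f k (S k g (S ?D (inv g) (S ?D g x))))) \<partial>M)"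
      using integral_S[OF bounded_byD(1)[OF b2[OF g]] D gc] by simp
    also have "\<dots> = (\<integral>x. b x * ((\<Prod>k=1..e. f k (S k g x)) * u (S ?D g x)) \<partial>M)"
      using S_inv[OF D gc] by (intro Bochner_Integration.integral_cong) simp_all
    finally show ?thesis by simp
  qed
  have "(\<integral>x. b x * avg_last e f u n x \<partial>M) =
      favg n (\<lambda>g. \<integral>x. b x * ((\<Prod>k=1..e. f k (S k g x)) * u (S ?D g x)) \<partial>M)"
    unfolding avg_last_def favg_mult
    by (rule integral_favg) (rule bounded_by_integrable[OF b1])
  also have "\<dots> = favg n (\<lambda>g. \<integral>x. u x * (b (S ?D (inv g) x) * (\<Prod>k=1..e. f k (S k g (S ?D (inv g) x)))) \<partial>M)"
    by (rule favg_cong) (rule eq)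
  also have "\<dots> = (\<integral>x. u x * dual e b f n x \<partial>M)"
    unfolding dual_def favg_mult
    by (rule integral_favg[symmetric]) (rule bounded_by_integrable[OF b2])
  finally show ?thesis .
qed

section \<open>Dual functions as last functions: reduction to one function fewer\<close>

text \<open>Both terms average the same function \<open>\<Phi>\<close> of modulus at most 1, one
  over \<open>F n\<close> and the other over its translate by \<open>l\<close>. Near-invariance of
  \<open>F n\<close> therefore trades the shift by \<open>S (Suc e) l\<close> for shifts by
  \<open>S k l\<close> with \<open>k \<le> e\<close>.\<close>

lemma norm_dual_shift:
  assumes e: "Suc e \<le> d" and b: "\<And>k. k \<in> {1..e} \<Longrightarrow> bounded_by 1 (b k)" "bounded_by 1 b0"
    and l: "l \<in> carrier G" and x: "x \<in> space M"
  shows "norm (dual e b0 b n (S (Suc e) l x) - favg n (\<lambda>m. b0 (S (Suc e) (inv m) x) *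
     (\<Prod>k=1..e. b k (S k m (S (Suc e) (inv m) (S k l x))))))
    \<le> real (card (sym_diff (l <# F n) (F n))) / real (card (F n))"
proof -
  let ?D = "Suc e"
  define \<Phi> where "\<Phi> g = b0 (S ?D (inv g \<otimes> l) x) * (\<Prod>k=1..e. b k (S k g (S ?D (inv g \<otimes> l) x)))" for g
  have D: "?D \<in> {1..d}" using e by simp
  have 1: "dual e b0 b n (S ?D l x) = favg n \<Phi>"
    unfolding dual_def \<Phi>_def
    by (rule favg_cong) (simp add: S_mult[OF D _ l x] F_carrier)
  \<comment> \<open>At \<open>l \<otimes> m\<close> the factor
    \<open>inv (l \<otimes> m) \<otimes> l\<close> cancels to \<open>inv m\<close>.
    \<open>S_commute\<close> brings \<open>S k l\<close> to the outside, where it merges with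
    \<open>S k m\<close> into \<open>S k (l \<otimes> m)\<close>.\<close>
  have 2: "b0 (S ?D (inv m) x) * (\<Prod>k=1..e. b k (S k m (S ?D (inv m) (S k l x)))) = \<Phi> (l \<otimes> m)"
    if "m \<in> F n" for m
  proof -
    have m: "m \<in> carrier G" using that F_carrier by blast
    have "inv (l \<otimes> m) \<otimes> l = inv m" using l m by (simp add: inv_mult_group m_assoc)
    moreover have "S k m (S ?D (inv m) (S k l x)) = S k (l \<otimes> m) (S ?D (inv m) x)" if "k \<in> {1..e}" for k
      using S_commute[of k ?D l m x] S_mult[of k l m "S ?D (inv m) x"] S_space[OF D, of "inv m" x] that e l m x
      by simp
    ultimately show ?thesis unfolding \<Phi>_def by simp
  qed
  have "(\<Sum>m\<in>F n. \<Phi> (l \<otimes> m)) = sum \<Phi> (l <# F n)"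
  proof -
    have "l <# F n = (\<lambda>m. l \<otimes> m) ` F n" by (auto simp: l_coset_def)
    moreover have "inj_on (\<lambda>m. l \<otimes> m) (F n)"
      using l by (auto simp: inj_on_def F_carrier)
    ultimately show ?thesis by (simp add: sum.reindex)
  qed
  then have 3: "favg n \<Phi> - favg n (\<lambda>m. \<Phi> (l \<otimes> m)) = (sum \<Phi> (F n) - sum \<Phi> (l <# F n)) / of_nat (card (F n))"
    unfolding favg_def by (simp add: diff_divide_distrib)
  have fin: "finite (l <# F n)" by (simp add: l_coset_def)
  have lF: "l <# F n \<subseteq> carrier G" using l F_subset by (auto simp: l_coset_def F_carrier)
  have "norm (\<Phi> g) \<le> 1" if "g \<in> F n \<union> (l <# F n)" for g
  proof -
    have g: "g \<in> carrier G" using that lF F_subset by blast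
    have y: "S ?D (inv g \<otimes> l) x \<in> space M" using S_space[OF D] g l x by simp
    have "norm (b k (S k g (S ?D (inv g \<otimes> l) x))) \<le> 1" if "k \<in> {1..e}" for k
      using bounded_byD(2)[OF b(1)[OF that] S_space[OF _ g y]] that e by simp
    then have "norm (\<Prod>k=1..e. b k (S k g (S ?D (inv g \<otimes> l) x))) \<le> 1"
      by (auto simp flip: prod_norm intro!: prod_le_1)
    with bounded_byD(2)[OF b(2) y] show ?thesis
      unfolding \<Phi>_def norm_mult by (intro mult_le_one) auto
  qed
  then have "norm (sum \<Phi> (F n) - sum \<Phi> (l <# F n)) \<le> real (card (sym_diff (l <# F n) (F n)))"
    by (intro norm_sum_diff_le_card_sym_diff) (auto simp: fin)
  moreover have "favg n (\<lambda>m. b0 (S ?D (inv m) x) *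
      (\<Prod>k=1..e. b k (S k m (S ?D (inv m) (S k l x))))) = favg n (\<lambda>m. \<Phi> (l \<otimes> m))"
    by (rule favg_cong) (rule 2)
  ultimately show ?thesis
    unfolding 1 3[symmetric] using 3 by (simp add: norm_divide divide_right_mono)
qed

lemma norm_prod_S_le:
  assumes "e \<le> d" "\<And>k. k \<in> {1..e} \<Longrightarrow> bounded_by 1 (f k)" "g \<in> carrier G" "x \<in> space M"
  shows "norm (\<Prod>k=1..e. f k (S k g x)) \<le> 1"
  using bounded_byD(2)[OF bounded_by_prod1[OF bounded_by_S], of "{1..e}" f "\<lambda>k. k" "\<lambda>_. g" x] assms
  by simp

text \<open>After the shift each factor from \<open>b k\<close> is evaluated at
  \<open>S k l x\<close>, so it can be absorbed into \<open>f k\<close>. The factor from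
  \<open>b0\<close> does not depend on \<open>l\<close>; interchanging the two averages leaves, for
  each \<open>m\<close>, an average of only \<open>e\<close> functions.\<close>

lemma norm_avg_last_dual:
  assumes e: "Suc e \<le> d" and f: "\<And>k. k \<in> {1..e} \<Longrightarrow> bounded_by 1 (f k)"
    and b: "\<And>k. k \<in> {1..e} \<Longrightarrow> bounded_by 1 (b k)" "bounded_by 1 b0"
    and x: "x \<in> space M"
    and \<eta>: "\<And>l. l \<in> F n \<Longrightarrow> real (card (sym_diff (l <# F n') (F n'))) / real (card (F n')) \<le> \<eta>"
  shows "norm (avg_last e f (dual e b0 b n') n x - favg n' (\<lambda>m. b0 (S (Suc e) (inv m) x) *
     avg e (\<lambda>k y. f k y * b k (S k m (S (Suc e) (inv m) y))) n x)) \<le> \<eta>"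
proof -
  let ?D = "Suc e"
  let ?P = "\<lambda>l. \<Prod>k=1..e. f k (S k l x)"
  let ?Q = "\<lambda>l. favg n' (\<lambda>m. b0 (S ?D (inv m) x) * (\<Prod>k=1..e. b k (S k m (S ?D (inv m) (S k l x)))))"
  have "favg n' (\<lambda>m. b0 (S ?D (inv m) x) * avg e (\<lambda>k y. f k y * b k (S k m (S ?D (inv m) y))) n x)
    = favg n (\<lambda>l. ?P l * ?Q l)"
    unfolding avg_def favg_mult by (subst favg_swap) (simp add: prod.distrib mult_ac)
  then have "avg_last e f (dual e b0 b n') n x - favg n' (\<lambda>m. b0 (S (Suc e) (inv m) x) *
     avg e (\<lambda>k y. f k y * b k (S k m (S (Suc e) (inv m) y))) n x) =
     favg n (\<lambda>l. ?P l * (dual e b0 b n' (S ?D l x) - ?Q l))"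
    unfolding avg_last_def by (simp add: favg_diff right_diff_distrib)
  moreover have "norm (?P l * (dual e b0 b n' (S ?D l x) - ?Q l)) \<le> \<eta>" if "l \<in> F n" for l
  proof -
    have l: "l \<in> carrier G" using that F_carrier by blast
    have 1: "norm (?P l) \<le> 1" using e f l x by (intro norm_prod_S_le) auto
    have 2: "norm (dual e b0 b n' (S ?D l x) - ?Q l) \<le> \<eta>"
      using norm_dual_shift[of e b b0 l x n'] e b l x \<eta>[OF that] by (meson order_trans)
    show ?thesis unfolding norm_mult
      using mult_mono[OF 1 2] by simp
  qed
  ultimately show ?thesis by (simp add: norm_favg_le)
qed

text \<open>The approximation error \<open>\<eta>\<close> is paid once at \<open>n1\<close> and once
  at \<open>n2\<close>. The factor from \<open>b0\<close> is the same at both indices and has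
  modulus at most 1, so it disappears from the bound.\<close>

lemma integral_norm_avg_last_dual_diff:
  assumes e: "Suc e \<le> d" and f: "\<And>k. k \<in> {1..e} \<Longrightarrow> bounded_by 1 (f k)"
    and b: "\<And>k. k \<in> {1..e} \<Longrightarrow> bounded_by 1 (b k)" "bounded_by 1 b0"
    and \<eta>: "\<And>l. l \<in> F n1 \<union> F n2 \<Longrightarrow>
      real (card (sym_diff (l <# F n') (F n'))) / real (card (F n')) \<le> \<eta>"
  defines "h \<equiv> \<lambda>m k y. f k y * b k (S k m (S (Suc e) (inv m) y))"
  shows "(\<integral>x. norm (avg_last e f (dual e b0 b n') n1 x - avg_last e f (dual e b0 b n') n2 x) \<partial>M)
    \<le> 2 * \<eta> + (1 / card (F n')) * (\<Sum>m\<in>F n'. \<integral>x. norm (avg e (h m) n1 x - avg e (h m) n2 x) \<partial>M)"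
proof -
  let ?D = "Suc e"
  have h: "bounded_by 1 (h m k)" if "m \<in> carrier G" "k \<in> {1..e}" for m k
    unfolding h_def using e f b that
    by (intro bounded_by_mult1 bounded_by_S[where f = "\<lambda>x. b _ (S _ _ x)"] bounded_by_S) auto
  have avgh: "bounded_by 1 (avg e (h m) n)" if "m \<in> carrier G" for m n
    using e h[OF that] by (intro bounded_by_avg) auto
  have ih: "integrable M (\<lambda>x. norm (avg e (h m) n1 x - avg e (h m) n2 x))" if "m \<in> F n'" for m
    using bounded_by_integrable[OF bounded_by_diff[OF avgh avgh]] F_carrier[OF that] by simp
  have bl: "bounded_by 1 (avg_last e f (dual e b0 b n') n)" for n
    by (intro bounded_by_avg_last bounded_by_dual e f b)
  have il: "integrable M (\<lambda>x. norm (avg_last e f (dual e b0 b n') n1 x - avg_last e f (dual e b0 b n') n2 x))"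
    by (intro integrable_norm bounded_by_integrable[OF bounded_by_diff[OF bl bl]])
  let ?B = "\<lambda>n x. avg_last e f (dual e b0 b n') n x"
  let ?Q = "\<lambda>n x. favg n' (\<lambda>m. b0 (S ?D (inv m) x) * avg e (h m) n x)"
  have pt: "norm (?B n1 x - ?B n2 x) \<le> 2 * \<eta> + (1 / card (F n')) *
      (\<Sum>m\<in>F n'. norm (avg e (h m) n1 x - avg e (h m) n2 x))" if x: "x \<in> space M" for x
  proof -
    have 1: "norm (?B n1 x - ?Q n1 x) \<le> \<eta>" "norm (?B n2 x - ?Q n2 x) \<le> \<eta>"
      unfolding h_def using \<eta> by (intro norm_avg_last_dual e f b x; simp)+
    have "norm (?Q n1 x - ?Q n2 x) = norm (favg n' (\<lambda>m. b0 (S ?D (inv m) x) * (avg e (h m) n1 x - avg e (h m) n2 x)))"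
      by (simp add: favg_diff right_diff_distrib)
    also have "\<dots> \<le> (1 / card (F n')) * (\<Sum>m\<in>F n'. norm (b0 (S ?D (inv m) x) * (avg e (h m) n1 x - avg e (h m) n2 x)))"
      by (rule norm_favg)
    also have "\<dots> \<le> (1 / card (F n')) * (\<Sum>m\<in>F n'. norm (avg e (h m) n1 x - avg e (h m) n2 x))"
    proof (intro mult_left_mono sum_mono)
      fix m assume "m \<in> F n'"
      then have "norm (b0 (S ?D (inv m) x)) \<le> 1"
        using bounded_byD(2)[OF b(2)] S_space[of ?D "inv m" x] e x F_carrier by simp
      then show "norm (b0 (S ?D (inv m) x) * (avg e (h m) n1 x - avg e (h m) n2 x))
          \<le> norm (avg e (h m) n1 x - avg e (h m) n2 x)"
        unfolding norm_mult by (rule mult_left_le_one_le[rotated 2]) auto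
    qed simp
    finally have 2: "norm (?Q n1 x - ?Q n2 x) \<le> (1 / card (F n')) * (\<Sum>m\<in>F n'. norm (avg e (h m) n1 x - avg e (h m) n2 x))" .
    have "norm (?B n1 x - ?B n2 x) \<le> norm (?B n1 x - ?Q n1 x) + norm (?Q n1 x - ?Q n2 x) + norm (?B n2 x - ?Q n2 x)"
      by norm
    with 1 2 show ?thesis by linarith
  qed
  have "(\<integral>x. norm (?B n1 x - ?B n2 x) \<partial>M) \<le> (\<integral>x. 2 * \<eta> + (1 / card (F n')) *
      (\<Sum>m\<in>F n'. norm (avg e (h m) n1 x - avg e (h m) n2 x)) \<partial>M)"
    using ih pt by (intro integral_mono il Bochner_Integration.integrable_add integrable_mult_right
      Bochner_Integration.integrable_sum) auto
  also have "\<dots> = 2 * \<eta> + (1 / card (F n')) * (\<Sum>m\<in>F n'. \<integral>x. norm (avg e (h m) n1 x - avg e (h m) n2 x) \<partial>M)"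
    using ih by (subst Bochner_Integration.integral_add) (auto simp: prob_space Bochner_Integration.integral_sum)
  finally show ?thesis .
qed

section \<open>Correlation with dual functions\<close>

text \<open>Working with the \<open>L\<^sup>1\<close> norm, the test function \<open>sgn\<close> is bounded by 1 whatever the size of \<open>u\<close>;
  this makes the energy decrement below independent of the number of steps already taken.\<close>

lemma integral_norm_avg_last_eq_dual:
  assumes e: "Suc e \<le> d" and f: "\<And>k. k \<in> {1..e} \<Longrightarrow> bounded_by 1 (f k)" and u: "bounded_by C u"
  shows "(\<integral>x. norm (avg_last e f u n x) \<partial>M) =
    Re (\<integral>x. u x * cnj (dual e (\<lambda>x. sgn (avg_last e f u n x)) (\<lambda>k x. cnj (f k x)) n x) \<partial>M)"
proof -
  have B: "avg_last e f u n \<in> borel_measurable M"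
    using bounded_by_avg_last[of e f C u n] e f u bounded_byD(1) by blast
  \<comment> \<open>Since \<open>cnj (sgn z) * z\<close> is the modulus of \<open>z\<close>, testing
    against the conjugate sign recovers the full L^1 norm, to which adjointness is then
    applied.\<close>
  have "(\<integral>x. cnj (sgn (avg_last e f u n x)) * avg_last e f u n x \<partial>M) =
      (\<integral>x. complex_of_real (norm (avg_last e f u n x)) \<partial>M)"
    by (intro Bochner_Integration.integral_cong refl)
      (simp add: sgn_div_norm complex_norm_square[symmetric] scaleR_conv_of_real field_simps power2_eq_square)
  then show ?thesis
    using integral_avg_last_mult[of e f C u "\<lambda>x. cnj (sgn (avg_last e f u n x))" n] e f u
      bounded_by_cnj[OF bounded_by_sgn[OF B]]
    by (simp add: cnj_dual) (metis Re_complex_of_real)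
qed

text \<open>Expand the square; the quadratic term is at most \<open>c\<^sup>2\<close> because
  \<open>v\<close> has modulus at most 1 and the measure has total mass 1.\<close>

lemma integral_norm_square_diff_le:
  assumes u: "bounded_by C u" and v: "bounded_by 1 v"
  shows "(\<integral>x. (norm (u x - of_real c * v x))\<^sup>2 \<partial>M) \<le>
    (\<integral>x. (norm (u x))\<^sup>2 \<partial>M) - 2 * c * Re (\<integral>x. u x * cnj (v x) \<partial>M) + c\<^sup>2"
proof -
  have sq: "integrable M (\<lambda>x. (norm (h x))\<^sup>2)" if "bounded_by B h" for h B
    using that unfolding bounded_by_def
    by (intro integrable_const_bound[where B = "B\<^sup>2"]) (auto intro!: power_mono)
  have uv: "integrable M (\<lambda>x. u x * cnj (v x))"
    by (rule bounded_by_integrable[OF bounded_by_mult[OF u bounded_by_cnj[OF v]]])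
  have cv: "bounded_by (norm (of_real c :: complex) * 1) (\<lambda>x. of_real c * v x)"
    by (rule bounded_by_mult[OF _ v]) (simp add: bounded_by_def)
  have pt: "(norm (u x - of_real c * v x))\<^sup>2 \<le> (norm (u x))\<^sup>2 - 2 * c * Re (u x * cnj (v x)) + c\<^sup>2"
    if "x \<in> space M" for x
  proof -
    have "(norm (u x - of_real c * v x))\<^sup>2 = (norm (u x))\<^sup>2 - 2 * c * Re (u x * cnj (v x)) + c\<^sup>2 * (norm (v x))\<^sup>2"
      unfolding cmod_power2 by (simp add: power2_eq_square algebra_simps)
    moreover have "(norm (v x))\<^sup>2 \<le> 1"
      using bounded_byD(2)[OF v that] by (simp add: power_le_one)
    ultimately show ?thesis
      using mult_left_mono[of "(norm (v x))\<^sup>2" 1 "c\<^sup>2"] by simp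
  qed
  have "(\<integral>x. (norm (u x - of_real c * v x))\<^sup>2 \<partial>M) \<le>
      (\<integral>x. (norm (u x))\<^sup>2 - 2 * c * Re (u x * cnj (v x)) + c\<^sup>2 \<partial>M)"
    using uv pt by (intro integral_mono sq[OF bounded_by_diff[OF u cv]] Bochner_Integration.integrable_add
      Bochner_Integration.integrable_diff sq[OF u] integrable_mult_right integrable_Re) auto
  also have "\<dots> = (\<integral>x. (norm (u x))\<^sup>2 \<partial>M) - 2 * c * Re (\<integral>x. u x * cnj (v x) \<partial>M) + c\<^sup>2"
    using sq[OF u] uv integrable_Re[OF uv] integral_Re[OF uv]
    by (simp add: prob_space)
  finally show ?thesis .
qed

section \<open>Metastability, uniform over weighted families\<close>

text \<open>The total weight is at most 1 rather than equal to 1, so that the class is stable under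
  the extension in \<open>metastable_structured\<close>, which multiplies the total by
  \<open>t / T\<close>.\<close>

definition unit_family :: "nat \<Rightarrow> 'i set \<Rightarrow> ('i \<Rightarrow> real) \<Rightarrow> ('i \<Rightarrow> nat \<Rightarrow> 'a \<Rightarrow> complex) \<Rightarrow> bool" where
  "unit_family e I w f \<longleftrightarrow> finite I \<and> (\<forall>i\<in>I. 0 \<le> w i) \<and> sum w I \<le> 1 \<and>
     (\<forall>i\<in>I. \<forall>k\<in>{1..e}. bounded_by 1 (f i k))"

text \<open>Uniformity over finite weighted families, and not only over single tuples, is what survives the
  averaging over \<open>m\<close> in a dual function. Lists as indices allow a family to be extended by a further
  parameter without changing the type.\<close>

definition metastable :: "nat \<Rightarrow> bool" where
  "metastable e \<longleftrightarrow> (\<forall>\<epsilon>>0. \<forall>H :: nat \<Rightarrow> nat. \<exists>K. \<forall>(I :: ('g \<times> nat) list set) w f.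
     unit_family e I w f \<longrightarrow> (\<exists>m\<le>K. \<forall>n1\<in>{m..H m}. \<forall>n2\<in>{m..H m}.
       (\<Sum>i\<in>I. w i * (\<integral>x. norm (avg e (f i) n1 x - avg e (f i) n2 x) \<partial>M)) \<le> \<epsilon>))"

text \<open>Only finitely many \<open>l\<close> occur in the sets \<open>F n\<close> with
  \<open>n \<le> L\<close>, so one threshold serves all of them.\<close>

lemma Folner_uniform:
  assumes "0 < \<eta>"
  shows "\<exists>\<theta>. \<forall>n'\<ge>\<theta>. \<forall>n\<le>L. \<forall>l\<in>F n. real (card (sym_diff (l <# F n') (F n'))) / real (card (F n')) \<le> \<eta>"
proof -
  have "\<forall>\<^sub>F n' in sequentially. real (card (sym_diff (l <# F n') (F n'))) / real (card (F n')) \<le> \<eta>"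
    if "l \<in> (\<Union>n\<le>L. F n)" for l
  proof -
    have "(\<lambda>n. real (card (sym_diff (l <# F n) (F n))) / real (card (F n))) \<longlonglongrightarrow> 0"
      using Folner that F_carrier by (auto simp: left_Folner_sequence_def)
    from order_tendstoD(2)[OF this assms] show ?thesis by (rule eventually_mono) simp
  qed
  then have "\<forall>\<^sub>F n' in sequentially. \<forall>l\<in>(\<Union>n\<le>L. F n).
      real (card (sym_diff (l <# F n') (F n'))) / real (card (F n')) \<le> \<eta>"
    by (intro eventually_ball_finite) auto
  then show ?thesis unfolding eventually_sequentially by (meson UN_I atMost_iff)
qed

text \<open>All the dual functions are treated at once: the averages of length \<open>e\<close> to
  which they reduce form one larger family, to which metastability for \<open>e\<close> applies. The
  threshold \<open>\<theta>\<close> is chosen after the bound on \<open>m\<close>, so that the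
  \<open>F (ns s)\<close> are nearly invariant under every \<open>F n\<close> that can occur in a
  window.\<close>

lemma metastable_structured:
  assumes meta: "metastable e" and e: "Suc e \<le> d" and \<epsilon>: "0 < \<epsilon>" and T: "0 < (T :: nat)"
  shows "\<exists>K \<theta>. \<forall>(I :: ('g \<times> nat) list set) w f b t ns b0. unit_family e I w f \<longrightarrow> unit_family e I w b \<longrightarrow>
     t \<le> T \<longrightarrow> (\<forall>s<t. \<theta> \<le> ns s \<and> (\<forall>i\<in>I. bounded_by 1 (b0 s i))) \<longrightarrow>
     (\<exists>m\<le>K. a \<le> m \<and> (\<forall>n1\<in>{m..H m}. \<forall>n2\<in>{m..H m}.
       (\<Sum>s<t. \<Sum>i\<in>I. w i * (\<integral>x. norm (avg_last e (f i) (dual e (b0 s i) (b i) (ns s)) n1 x -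
          avg_last e (f i) (dual e (b0 s i) (b i) (ns s)) n2 x) \<partial>M)) \<le> \<epsilon>))"
proof -
  \<comment> \<open>At most \<open>T\<close> dual functions, each with error
    \<open>2 * \<eta>\<close>, cost at most \<open>\<epsilon> / 2\<close>; the other half comes from
    the family bound \<open>\<epsilon> / (2 * real T)\<close> multiplied by
    \<open>T\<close>.\<close>
  define \<eta> where "\<eta> = \<epsilon> / (4 * real T)"
  have \<eta>: "0 < \<eta>" using \<epsilon> T by (simp add: \<eta>_def)
  have "0 < \<epsilon> / (2 * real T)" using \<epsilon> T by simp
  \<comment> \<open>The final witness is \<open>max a m\<close>. Its window up to
    \<open>H (max a m)\<close> lies inside the one that starts at \<open>m\<close>, hence this
    choice of growth function.\<close>
  from meta[unfolded metastable_def, THEN spec, THEN mp, OF this, THEN spec, of "\<lambda>m. H (max a m)"]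
  obtain K where K: "\<And>(I :: ('g \<times> nat) list set) w f. unit_family e I w f \<Longrightarrow>
      (\<exists>m\<le>K. \<forall>n1\<in>{m..H (max a m)}. \<forall>n2\<in>{m..H (max a m)}.
       (\<Sum>i\<in>I. w i * (\<integral>x. norm (avg e (f i) n1 x - avg e (f i) n2 x) \<partial>M)) \<le> \<epsilon> / (2 * real T))"
    by blast
  define L where "L = Max (H ` {..max a K})"
  have L: "n \<le> L" if "n \<le> H m" "m \<le> max a K" for n m
  proof -
    have "H m \<le> L" unfolding L_def using that(2) by (intro Max_ge) auto
    with that(1) show ?thesis by linarith
  qed
  obtain \<theta> where \<theta>: "\<And>n' n l. \<lbrakk>\<theta> \<le> n'; n \<le> L; l \<in> F n\<rbrakk> \<Longrightarrow>
      real (card (sym_diff (l <# F n') (F n'))) / real (card (F n')) \<le> \<eta>"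
    using Folner_uniform[OF \<eta>, of L] by blast
  show ?thesis
  proof (rule exI[of _ "max a K"], rule exI[of _ \<theta>], intro allI impI)
    fix I :: "('g \<times> nat) list set" and w f b t ns b0
    assume fam: "unit_family e I w f" "unit_family e I w b" and t: "t \<le> T"
      and st: "\<forall>s<t. \<theta> \<le> ns s \<and> (\<forall>i\<in>I. bounded_by 1 (b0 s i))"
    have fin: "finite I" and w: "\<And>i. i \<in> I \<Longrightarrow> 0 \<le> w i" and w1: "sum w I \<le> 1"
      and f: "\<And>i k. \<lbrakk>i \<in> I; k \<in> {1..e}\<rbrakk> \<Longrightarrow> bounded_by 1 (f i k)"
      and b: "\<And>i k. \<lbrakk>i \<in> I; k \<in> {1..e}\<rbrakk> \<Longrightarrow> bounded_by 1 (b i k)"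
      using fam by (auto simp: unit_family_def)
    let ?D = "Suc e"
    \<comment> \<open>An index of the larger family is an old index with the pair
      \<open>(m,s)\<close> prepended. Dividing by \<open>T\<close> and by the size of
      \<open>F (ns s)\<close> in \<open>w'\<close> keeps the total weight at most 1.\<close>
    define J where "J = (\<lambda>p. (snd (fst p), fst (fst p)) # snd p) ` ((SIGMA s:{..<t}. F (ns s)) \<times> I)"
    define w' where "w' j = w (tl j) / (real T * real (card (F (ns (snd (hd j))))))" for j
    define h where "h i m k y = f i k y * b i k (S k m (S ?D (inv m) y))" for i m k y
    define f' where "f' j = h (tl j) (fst (hd j))" for j
    have sumJ: "(\<Sum>j\<in>J. \<phi> j) = (\<Sum>s<t. \<Sum>m\<in>F (ns s). \<Sum>i\<in>I. \<phi> ((m,s) # i))" for \<phi> :: "('g \<times> nat) list \<Rightarrow> real"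
    proof -
      have "inj_on (\<lambda>p. (snd (fst p), fst (fst p)) # snd p) ((SIGMA s:{..<t}. F (ns s)) \<times> I)"
        by (auto simp: inj_on_def)
      then have "(\<Sum>j\<in>J. \<phi> j) = (\<Sum>p\<in>(SIGMA s:{..<t}. F (ns s)) \<times> I. \<phi> ((snd (fst p), fst (fst p)) # snd p))"
        unfolding J_def by (simp add: sum.reindex)
      also have "\<dots> = (\<Sum>q\<in>(SIGMA s:{..<t}. F (ns s)). \<Sum>i\<in>I. \<phi> ((snd q, fst q) # i))"
        by (simp add: sum.cartesian_product case_prod_beta)
      also have "\<dots> = (\<Sum>s<t. \<Sum>m\<in>F (ns s). \<Sum>i\<in>I. \<phi> ((m,s) # i))"
        by (subst sum.Sigma) (auto simp: case_prod_beta)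
      finally show ?thesis .
    qed
    have "unit_family e J w' f'"
      unfolding unit_family_def
    proof (intro conjI ballI)
      show "finite J" unfolding J_def using fin by auto
      show "0 \<le> w' j" if "j \<in> J" for j
        using that w by (auto simp: J_def w'_def)
      have "sum w' J = (\<Sum>s<t. (\<Sum>i\<in>I. w i) / real T)"
        unfolding sumJ w'_def using card_F_pos by (simp flip: sum_divide_distrib)
      also have "\<dots> = real t / real T * sum w I" by simp
      also have "\<dots> \<le> 1" using t T w1 w by (intro mult_le_one sum_nonneg) auto
      finally show "sum w' J \<le> 1" .
      show "bounded_by 1 (f' j k)" if "j \<in> J" "k \<in> {1..e}" for j k
        using that e F_carrier unfolding f'_def h_def J_def
        by (auto intro!: bounded_by_mult1 f bounded_by_S[where f = "\<lambda>x. b _ _ (S _ _ x)"] bounded_by_S b)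
    qed
    then obtain m0 where m0: "m0 \<le> K" "\<And>n1 n2. \<lbrakk>n1 \<in> {m0..H (max a m0)}; n2 \<in> {m0..H (max a m0)}\<rbrakk> \<Longrightarrow>
       (\<Sum>i\<in>J. w' i * (\<integral>x. norm (avg e (f' i) n1 x - avg e (f' i) n2 x) \<partial>M)) \<le> \<epsilon> / (2 * real T)"
      using K by blast
    let ?m = "max a m0"
    have "(\<Sum>s<t. \<Sum>i\<in>I. w i * (\<integral>x. norm (avg_last e (f i) (dual e (b0 s i) (b i) (ns s)) n1 x -
          avg_last e (f i) (dual e (b0 s i) (b i) (ns s)) n2 x) \<partial>M)) \<le> \<epsilon>"
      if n: "n1 \<in> {?m..H ?m}" "n2 \<in> {?m..H ?m}" for n1 n2
    proof -
      let ?c = "\<lambda>s. real (card (F (ns s)))"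
      let ?X = "\<lambda>i m. \<integral>x. norm (avg e (h i m) n1 x - avg e (h i m) n2 x) \<partial>M"
      have "?m \<le> max a K" using m0 by auto
      then have nL: "n1 \<le> L" "n2 \<le> L" using n L by auto
      have "(\<Sum>s<t. \<Sum>i\<in>I. w i * (\<integral>x. norm (avg_last e (f i) (dual e (b0 s i) (b i) (ns s)) n1 x -
          avg_last e (f i) (dual e (b0 s i) (b i) (ns s)) n2 x) \<partial>M))
        \<le> (\<Sum>s<t. \<Sum>i\<in>I. w i * (2 * \<eta> + (1 / ?c s) * (\<Sum>m\<in>F (ns s). ?X i m)))"
      proof (intro sum_mono mult_left_mono w)
        fix s i assume "s \<in> {..<t}" "i \<in> I"
        then show "(\<integral>x. norm (avg_last e (f i) (dual e (b0 s i) (b i) (ns s)) n1 x -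
          avg_last e (f i) (dual e (b0 s i) (b i) (ns s)) n2 x) \<partial>M) \<le> 2 * \<eta> + (1 / ?c s) * (\<Sum>m\<in>F (ns s). ?X i m)"
          unfolding h_def using st nL
          by (intro integral_norm_avg_last_dual_diff e f b) (auto intro: \<theta>)
      qed
      also have "\<dots> = real t * (2 * \<eta>) * sum w I + (\<Sum>s<t. \<Sum>i\<in>I. \<Sum>m\<in>F (ns s). w i / ?c s * ?X i m)"
        by (simp add: distrib_left sum.distrib sum_distrib_left sum_distrib_right mult_ac)
      also have "(\<Sum>s<t. \<Sum>i\<in>I. \<Sum>m\<in>F (ns s). w i / ?c s * ?X i m) =
          real T * (\<Sum>j\<in>J. w' j * (\<integral>x. norm (avg e (f' j) n1 x - avg e (f' j) n2 x) \<partial>M))"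
        unfolding sumJ w'_def f'_def using T
        by (subst sum.swap[of _ "F _"]) (simp add: sum_distrib_left)
      also have "\<dots> \<le> real T * (\<epsilon> / (2 * real T))"
        using m0(2)[of n1 n2] n by (intro mult_left_mono) auto
      also have "\<dots> = \<epsilon> / 2" using T by simp
      also have "real t * (2 * \<eta>) * sum w I \<le> real T * (2 * \<eta>) * 1"
        using t w1 w \<eta> by (intro mult_mono sum_nonneg) auto
      also have "\<dots> = \<epsilon> / 2" using T by (simp add: \<eta>_def)
      finally show ?thesis by simp
    qed
    then show "\<exists>m\<le>max a K. a \<le> m \<and> (\<forall>n1\<in>{m..H m}. \<forall>n2\<in>{m..H m}.
       (\<Sum>s<t. \<Sum>i\<in>I. w i * (\<integral>x. norm (avg_last e (f i) (dual e (b0 s i) (b i) (ns s)) n1 x -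
          avg_last e (f i) (dual e (b0 s i) (b i) (ns s)) n2 x) \<partial>M)) \<le> \<epsilon>)"
      using m0(1) by (intro exI[of _ ?m]) auto
  qed
qed

section \<open>Energy decrement and the induction step\<close>

text \<open>One coefficient \<open>c\<close>, the weighted total of the L^1 norms, is used for all
  \<open>i\<close>. The cross terms then add up to exactly \<open>2 * c * c\<close>, while the
  quadratic terms add at most \<open>c\<^sup>2\<close> since the weights sum to at most 1.\<close>

lemma energy_decrement:
  assumes fam: "unit_family e I w f" and e: "Suc e \<le> d"
    and u: "\<And>i. i \<in> I \<Longrightarrow> bounded_by C (u i)"
    and c: "c = (\<Sum>i\<in>I. w i * (\<integral>x. norm (avg_last e (f i) (u i) n x) \<partial>M))"
  shows "(\<Sum>i\<in>I. w i * (\<integral>x. (norm (u i x - of_real c *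
      dual e (\<lambda>x. sgn (avg_last e (f i) (u i) n x)) (\<lambda>k x. cnj (f i k x)) n x))\<^sup>2 \<partial>M))
    \<le> (\<Sum>i\<in>I. w i * (\<integral>x. (norm (u i x))\<^sup>2 \<partial>M)) - c\<^sup>2"
proof -
  have w: "\<And>i. i \<in> I \<Longrightarrow> 0 \<le> w i" and w1: "sum w I \<le> 1"
    and f: "\<And>i k. \<lbrakk>i \<in> I; k \<in> {1..e}\<rbrakk> \<Longrightarrow> bounded_by 1 (f i k)"
    using fam by (auto simp: unit_family_def)
  let ?\<sigma> = "\<lambda>i. dual e (\<lambda>x. sgn (avg_last e (f i) (u i) n x)) (\<lambda>k x. cnj (f i k x)) n"
  have "(\<integral>x. (norm (u i x - of_real c * ?\<sigma> i x))\<^sup>2 \<partial>M) \<le>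
      (\<integral>x. (norm (u i x))\<^sup>2 \<partial>M) - 2 * c * (\<integral>x. norm (avg_last e (f i) (u i) n x) \<partial>M) + c\<^sup>2"
    if i: "i \<in> I" for i
  proof -
    have "bounded_by C (avg_last e (f i) (u i) n)"
      by (intro bounded_by_avg_last e f u i)
    then have "bounded_by 1 (?\<sigma> i)"
      by (intro bounded_by_dual bounded_by_cnj bounded_by_sgn e f i bounded_byD(1))
    moreover have "(\<integral>x. norm (avg_last e (f i) (u i) n x) \<partial>M) = Re (\<integral>x. u i x * cnj (?\<sigma> i x) \<partial>M)"
      by (rule integral_norm_avg_last_eq_dual[OF e _ u[OF i]]) (rule f[OF i])
    ultimately show ?thesis using integral_norm_square_diff_le[OF u[OF i], of "?\<sigma> i" c] by simp
  qed
  then have "(\<Sum>i\<in>I. w i * (\<integral>x. (norm (u i x - of_real c * ?\<sigma> i x))\<^sup>2 \<partial>M)) \<le>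
      (\<Sum>i\<in>I. w i * ((\<integral>x. (norm (u i x))\<^sup>2 \<partial>M) -
        2 * c * (\<integral>x. norm (avg_last e (f i) (u i) n x) \<partial>M) + c\<^sup>2))"
    by (intro sum_mono mult_left_mono w)
  also have "\<dots> = (\<Sum>i\<in>I. w i * (\<integral>x. (norm (u i x))\<^sup>2 \<partial>M)) -
      2 * c * (\<Sum>i\<in>I. w i * (\<integral>x. norm (avg_last e (f i) (u i) n x) \<partial>M)) + c\<^sup>2 * sum w I"
    unfolding sum_distrib_left sum.distrib[symmetric] sum_subtractf[symmetric]
    by (intro sum.cong refl) (simp add: algebra_simps)
  also have "\<dots> = (\<Sum>i\<in>I. w i * (\<integral>x. (norm (u i x))\<^sup>2 \<partial>M)) - 2 * c * c + c\<^sup>2 * sum w I"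
    by (simp only: c[symmetric])
  also have "\<dots> \<le> (\<Sum>i\<in>I. w i * (\<integral>x. (norm (u i x))\<^sup>2 \<partial>M)) - c\<^sup>2"
    using mult_left_mono[OF w1, of "c\<^sup>2"] by (simp add: power2_eq_square)
  finally show ?thesis .
qed

text \<open>By linearity the oscillation splits into the residual at \<open>n1\<close>, the residual
  at \<open>n2\<close> and the oscillation of the dual part, each contributing at most
  \<open>\<epsilon>\<close>. Coefficients in the unit interval do not enlarge the dual part.\<close>

lemma oscillation_decomposition_le:
  assumes fam: "unit_family e I w f" and e: "Suc e \<le> d"
    and u: "\<And>i. i \<in> I \<Longrightarrow> bounded_by C (u i)"
    and \<sigma>: "\<And>i s. i \<in> I \<Longrightarrow> s < (t::nat) \<Longrightarrow> bounded_by 1 (\<sigma> s i)"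
    and c: "\<And>s. s < t \<Longrightarrow> 0 \<le> c s \<and> c s \<le> 1"
    and g: "\<And>i x. u i x = g i x - (\<Sum>s<t. of_real (c s) * \<sigma> s i x)"
    and small: "\<And>n. n \<in> {n1, n2} \<Longrightarrow> (\<Sum>i\<in>I. w i * (\<integral>x. norm (avg_last e (f i) (u i) n x) \<partial>M)) \<le> \<epsilon>"
    and osc: "(\<Sum>s<t. \<Sum>i\<in>I. w i * (\<integral>x. norm (avg_last e (f i) (\<sigma> s i) n1 x -
          avg_last e (f i) (\<sigma> s i) n2 x) \<partial>M)) \<le> \<epsilon>"
  shows "(\<Sum>i\<in>I. w i * (\<integral>x. norm (avg_last e (f i) (g i) n1 x - avg_last e (f i) (g i) n2 x) \<partial>M)) \<le> 3 * \<epsilon>"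
proof -
  have w: "\<And>i. i \<in> I \<Longrightarrow> 0 \<le> w i" 
    and f: "\<And>i k. \<lbrakk>i \<in> I; k \<in> {1..e}\<rbrakk> \<Longrightarrow> bounded_by 1 (f i k)"
    using fam by (auto simp: unit_family_def)
  let ?U = "\<lambda>i n x. avg_last e (f i) (u i) n x"
  let ?V = "\<lambda>i s n x. avg_last e (f i) (\<sigma> s i) n x"
  let ?W = "\<lambda>i n x. avg_last e (f i) (g i) n x"
  have W: "?W i n x = ?U i n x + (\<Sum>s<t. of_real (c s) * ?V i s n x)" for i n x
  proof -
    have "u i = (\<lambda>x. g i x - (\<Sum>s<t. of_real (c s) * \<sigma> s i x))" using g by blast
    then show ?thesis by (simp add: avg_last_diff avg_last_sum)
  qed
  have bU: "bounded_by C (?U i n)" if "i \<in> I" for i n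
    using that by (intro bounded_by_avg_last e f u)
  have bV: "bounded_by 1 (?V i s n)" if "i \<in> I" "s < t" for i n s
    using that by (intro bounded_by_avg_last e f \<sigma>)
  have iU: "integrable M (\<lambda>x. norm (?U i n x))" if "i \<in> I" for i n
    using bounded_by_integrable[OF bU[OF that]] by simp
  have iV: "integrable M (\<lambda>x. norm (?V i s n1 x - ?V i s n2 x))" if "i \<in> I" "s < t" for i s
    using bounded_by_integrable[OF bounded_by_diff[OF bV[OF that] bV[OF that]]] by simp
  have "(\<integral>x. norm (?W i n1 x - ?W i n2 x) \<partial>M) \<le> (\<integral>x. norm (?U i n1 x) \<partial>M) + (\<integral>x. norm (?U i n2 x) \<partial>M) +
      (\<Sum>s<t. \<integral>x. norm (?V i s n1 x - ?V i s n2 x) \<partial>M)" if i: "i \<in> I" for i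
  proof -
    have "norm (?W i n1 x - ?W i n2 x) \<le> norm (?U i n1 x) + norm (?U i n2 x) +
        (\<Sum>s<t. norm (?V i s n1 x - ?V i s n2 x))" for x
    proof -
      have "?W i n1 x - ?W i n2 x = ?U i n1 x - ?U i n2 x + (\<Sum>s<t. of_real (c s) * (?V i s n1 x - ?V i s n2 x))"
        by (simp add: W right_diff_distrib sum_subtractf)
      then have "norm (?W i n1 x - ?W i n2 x) \<le> norm (?U i n1 x) + norm (?U i n2 x) + (\<Sum>s<t. norm (of_real (c s) * (?V i s n1 x - ?V i s n2 x)))"
        by (simp only:) (rule order_trans[OF norm_triangle_ineq], intro add_mono norm_triangle_ineq4 norm_sum)
      moreover have "(\<Sum>s<t. norm (of_real (c s) * (?V i s n1 x - ?V i s n2 x))) \<le> (\<Sum>s<t. norm (?V i s n1 x - ?V i s n2 x))"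
      proof (rule sum_mono)
        fix s assume "s \<in> {..<t}"
        then have "0 \<le> c s" "c s \<le> 1" using c[of s] by simp_all
        then show "norm (of_real (c s) * (?V i s n1 x - ?V i s n2 x)) \<le> norm (?V i s n1 x - ?V i s n2 x)"
          unfolding norm_mult by (intro mult_left_le_one_le) auto
      qed
      ultimately show ?thesis by linarith
    qed
    then have "(\<integral>x. norm (?W i n1 x - ?W i n2 x) \<partial>M) \<le> (\<integral>x. norm (?U i n1 x) + norm (?U i n2 x) +
        (\<Sum>s<t. norm (?V i s n1 x - ?V i s n2 x)) \<partial>M)"
      using iU[OF i] iV[OF i]
      by (intro integral_mono' Bochner_Integration.integrable_add Bochner_Integration.integrable_sum)
        (auto intro!: add_nonneg_nonneg sum_nonneg)
    also have "\<dots> = (\<integral>x. norm (?U i n1 x) \<partial>M) + (\<integral>x. norm (?U i n2 x) \<partial>M) +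
        (\<Sum>s<t. \<integral>x. norm (?V i s n1 x - ?V i s n2 x) \<partial>M)"
    proof -
      have "integrable M (\<lambda>x. \<Sum>s<t. norm (?V i s n1 x - ?V i s n2 x))"
        using iV[OF i] by (intro Bochner_Integration.integrable_sum) auto
      moreover have "(\<integral>x. (\<Sum>s<t. norm (?V i s n1 x - ?V i s n2 x)) \<partial>M) =
          (\<Sum>s<t. \<integral>x. norm (?V i s n1 x - ?V i s n2 x) \<partial>M)"
        using iV[OF i] by (intro Bochner_Integration.integral_sum) auto
      ultimately show ?thesis using iU[OF i] by simp
    qed
    finally show ?thesis .
  qed
  then have "(\<Sum>i\<in>I. w i * (\<integral>x. norm (?W i n1 x - ?W i n2 x) \<partial>M)) \<le>
      (\<Sum>i\<in>I. w i * ((\<integral>x. norm (?U i n1 x) \<partial>M) + (\<integral>x. norm (?U i n2 x) \<partial>M) +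
      (\<Sum>s<t. \<integral>x. norm (?V i s n1 x - ?V i s n2 x) \<partial>M)))"
    by (intro sum_mono mult_left_mono w)
  also have "\<dots> = (\<Sum>i\<in>I. w i * (\<integral>x. norm (?U i n1 x) \<partial>M)) + (\<Sum>i\<in>I. w i * (\<integral>x. norm (?U i n2 x) \<partial>M)) +
      (\<Sum>s<t. \<Sum>i\<in>I. w i * (\<integral>x. norm (?V i s n1 x - ?V i s n2 x) \<partial>M))"
    by (subst sum.swap) (simp add: distrib_left sum.distrib sum_distrib_left)
  also have "\<dots> \<le> 3 * \<epsilon>" using small[of n1] small[of n2] osc by simp
  finally show ?thesis .
qed

text \<open>The residual \<open>u\<close> starts as the last function, with energy at most 1. As
  long as some index beyond the current scale has a residual average above
  \<open>\<epsilon>\<close>, \<open>advance\<close> subtracts a dual function at that index; once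
  there is none, \<open>stop\<close> combines the small residual with
  \<open>metastable_structured\<close>.\<close>

lemma metastable_Suc:
  assumes meta: "metastable e" and e: "Suc e \<le> d"
  shows "metastable (Suc e)"
  unfolding metastable_def
proof (intro allI impI)
  fix \<epsilon>' :: real and H :: "nat \<Rightarrow> nat" assume "0 < \<epsilon>'"
  define \<epsilon> where "\<epsilon> = \<epsilon>' / 3"
  have \<epsilon>: "0 < \<epsilon>" using \<open>0 < \<epsilon>'\<close> by (simp add: \<epsilon>_def)
  \<comment> \<open>Each step costs energy at least \<open>\<epsilon>\<^sup>2\<close>, so
    \<open>T\<close> steps exhaust an initial energy of at most 1.\<close>
  obtain T :: nat where "1 / \<epsilon>\<^sup>2 < real T" using reals_Archimedean2 by blast
  with \<epsilon> have T: "0 < T" "1 \<le> real T * \<epsilon>\<^sup>2"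
    by (auto simp: divide_less_eq intro!: Nat.gr0I)
  define good where "good a K \<theta> \<longleftrightarrow> (\<forall>(I :: ('g \<times> nat) list set) w f b t ns b0.
     unit_family e I w f \<longrightarrow> unit_family e I w b \<longrightarrow>
     t \<le> T \<longrightarrow> (\<forall>s<t. \<theta> \<le> ns s \<and> (\<forall>i\<in>I. bounded_by 1 (b0 s i))) \<longrightarrow>
     (\<exists>m\<le>K. a \<le> m \<and> (\<forall>n1\<in>{m..H m}. \<forall>n2\<in>{m..H m}.
       (\<Sum>s<t. \<Sum>i\<in>I. w i * (\<integral>x. norm (avg_last e (f i) (dual e (b0 s i) (b i) (ns s)) n1 x -
          avg_last e (f i) (dual e (b0 s i) (b i) (ns s)) n2 x) \<partial>M)) \<le> \<epsilon>)))" for a K \<theta>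
  have "\<forall>a. \<exists>K \<theta>. good a K \<theta>"
    unfolding good_def using metastable_structured[OF meta e \<epsilon> T(1)] by blast
  then obtain K \<theta> where good: "\<And>a. good a (K a) (\<theta> a)"
    by metis
  \<comment> \<open>\<open>sc r\<close> is the scale with \<open>r\<close> steps remaining: dual functions found earlier must live on
    larger scales, since their Folner sets have to be nearly invariant under all later ones.\<close>
  define sc where "sc = rec_nat 0 (\<lambda>_ a. max a (\<theta> a))"
  have sc_Suc: "sc (Suc r) = max (sc r) (\<theta> (sc r))" for r by (simp add: sc_def)
  \<comment> \<open>The process may stop at any stage \<open>r \<le> T\<close>. The maximum over
    these scales is fixed before the family is given, which yields the uniformity.\<close>
  define Kmax where "Kmax = Max ((\<lambda>r. K (sc r)) ` {..T})"
  have Kmax: "K (sc r) \<le> Kmax" if "r \<le> T" for r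
    unfolding Kmax_def using that by (intro Max_ge) auto
  show "\<exists>K. \<forall>(I :: ('g \<times> nat) list set) w f.
     unit_family (Suc e) I w f \<longrightarrow> (\<exists>m\<le>K. \<forall>n1\<in>{m..H m}. \<forall>n2\<in>{m..H m}.
       (\<Sum>i\<in>I. w i * (\<integral>x. norm (avg (Suc e) (f i) n1 x - avg (Suc e) (f i) n2 x) \<partial>M)) \<le> \<epsilon>')"
  proof (rule exI[of _ Kmax], intro allI impI)
    fix I :: "('g \<times> nat) list set" and w f
    assume fam': "unit_family (Suc e) I w f"
    define b where "b i k x = cnj (f i k x)" for i k x
    have w: "\<And>i. i \<in> I \<Longrightarrow> 0 \<le> w i" and w1: "sum w I \<le> 1"
      and f: "\<And>i k. \<lbrakk>i \<in> I; k \<in> {1..Suc e}\<rbrakk> \<Longrightarrow> bounded_by 1 (f i k)"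
      using fam' by (auto simp: unit_family_def)
    have b: "bounded_by 1 (b i k)" if "i \<in> I" "k \<in> {1..Suc e}" for i k
      unfolding b_def by (intro bounded_by_cnj f that)
    have fam: "unit_family e I w f" "unit_family e I w b"
      using fam' b by (auto simp: unit_family_def)
    define \<sigma> where "\<sigma> ns b0 s i = dual e (b0 s i) (b i) (ns s)" for ns :: "nat \<Rightarrow> nat" and b0 and s :: nat and i
    define u where "u t c ns b0 i x = f i (Suc e) x - (\<Sum>s<t. of_real (c s) * \<sigma> ns b0 s i x)"
      for t :: nat and c :: "nat \<Rightarrow> real" and ns b0 i x
    define E where "E t c ns b0 = (\<Sum>i\<in>I. w i * (\<integral>x. (norm (u t c ns b0 i x))\<^sup>2 \<partial>M))" for t c ns b0
    have E_nonneg: "0 \<le> E t c ns b0" for t c ns b0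
      unfolding E_def by (intro sum_nonneg mult_nonneg_nonneg w) auto
    \<comment> \<open>A stage with \<open>r\<close> steps remaining carries
      \<open>admissible (Suc r)\<close>: the dual functions found so far live beyond
      \<open>sc (Suc r)\<close>, hence beyond \<open>\<theta> (sc r)\<close>, whereas the next index
      need only be at least \<open>sc r\<close>.\<close>
    define admissible where "admissible r t c ns b0 \<longleftrightarrow>
      (\<forall>s<t. 0 \<le> c s \<and> c s \<le> 1 \<and> sc r \<le> ns s \<and> (\<forall>i\<in>I. bounded_by 1 (b0 s i)))"
      for r t :: nat and c :: "nat \<Rightarrow> real" and ns :: "nat \<Rightarrow> nat" and b0
    have \<sigma>1: "bounded_by 1 (\<sigma> ns b0 s i)" if "admissible r t c ns b0" "s < t" "i \<in> I" for r t c ns b0 s i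
      unfolding \<sigma>_def using that b e by (intro bounded_by_dual) (auto simp: admissible_def)
    have uC: "bounded_by (1 + real t) (u t c ns b0 i)" if adm: "admissible r t c ns b0" and i: "i \<in> I" for r t c ns b0 i
    proof -
      have "bounded_by 1 (\<lambda>x. of_real (c s) * \<sigma> ns b0 s i x)" if "s < t" for s
        using adm that by (intro bounded_by_mult1 \<sigma>1[OF adm that i]) (auto simp: bounded_by_def admissible_def)
      then have "bounded_by (\<Sum>s<t. 1) (\<lambda>x. \<Sum>s<t. of_real (c s) * \<sigma> ns b0 s i x)"
        by (intro bounded_by_sum) auto
      then have "bounded_by (1 + (\<Sum>s<t. 1)) (\<lambda>x. f i (Suc e) x - (\<Sum>s<t. of_real (c s) * \<sigma> ns b0 s i x))"
        using i by (intro bounded_by_diff f) auto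
      then show ?thesis unfolding u_def by simp
    qed
    define L where "L t c ns b0 n = (\<Sum>i\<in>I. w i * (\<integral>x. norm (avg_last e (f i) (u t c ns b0 i) n x) \<partial>M))"
      for t c ns b0 n
    have stop: "\<exists>m\<le>Kmax. \<forall>n1\<in>{m..H m}. \<forall>n2\<in>{m..H m}.
       (\<Sum>i\<in>I. w i * (\<integral>x. norm (avg_last e (f i) (f i (Suc e)) n1 x - avg_last e (f i) (f i (Suc e)) n2 x) \<partial>M)) \<le> 3 * \<epsilon>"
      if tr: "t + r = T" and adm: "admissible (Suc r) t c ns b0" and small: "\<And>n. sc r \<le> n \<Longrightarrow> L t c ns b0 n \<le> \<epsilon>"
      for t r c ns b0
    proof -
      have st: "\<forall>s<t. \<theta> (sc r) \<le> ns s \<and> (\<forall>i\<in>I. bounded_by 1 (b0 s i))"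
        using adm by (auto simp: admissible_def sc_Suc)
      have "t \<le> T" using tr by simp
      then have "\<exists>m\<le>K (sc r). sc r \<le> m \<and> (\<forall>n1\<in>{m..H m}. \<forall>n2\<in>{m..H m}.
        (\<Sum>s<t. \<Sum>i\<in>I. w i * (\<integral>x. norm (avg_last e (f i) (\<sigma> ns b0 s i) n1 x -
          avg_last e (f i) (\<sigma> ns b0 s i) n2 x) \<partial>M)) \<le> \<epsilon>)"
        unfolding \<sigma>_def using st
        by (rule good[of "sc r", unfolded good_def, THEN spec, THEN spec, THEN spec, THEN spec,
            THEN spec, THEN spec, THEN spec, THEN mp, THEN mp, THEN mp, THEN mp, OF fam])
      then obtain m where m: "m \<le> K (sc r)" "sc r \<le> m" and osc: "\<And>n1 n2. \<lbrakk>n1 \<in> {m..H m}; n2 \<in> {m..H m}\<rbrakk> \<Longrightarrow>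
        (\<Sum>s<t. \<Sum>i\<in>I. w i * (\<integral>x. norm (avg_last e (f i) (\<sigma> ns b0 s i) n1 x -
          avg_last e (f i) (\<sigma> ns b0 s i) n2 x) \<partial>M)) \<le> \<epsilon>"
        by blast
      have "(\<Sum>i\<in>I. w i * (\<integral>x. norm (avg_last e (f i) (f i (Suc e)) n1 x - avg_last e (f i) (f i (Suc e)) n2 x) \<partial>M)) \<le> 3 * \<epsilon>"
        if n: "n1 \<in> {m..H m}" "n2 \<in> {m..H m}" for n1 n2
      proof (rule oscillation_decomposition_le[OF fam(1) e])
        show "bounded_by (1 + real t) (u t c ns b0 i)" if "i \<in> I" for i by (rule uC[OF adm that])
        show "bounded_by 1 (\<sigma> ns b0 s i)" if "i \<in> I" "s < t" for i s by (rule \<sigma>1[OF adm that(2,1)])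
        show "0 \<le> c s \<and> c s \<le> 1" if "s < t" for s using adm that by (simp add: admissible_def)
        show "u t c ns b0 i x = f i (Suc e) x - (\<Sum>s<t. of_real (c s) * \<sigma> ns b0 s i x)" for i x
          by (simp add: u_def)
        show "(\<Sum>i\<in>I. w i * (\<integral>x. norm (avg_last e (f i) (u t c ns b0 i) n x) \<partial>M)) \<le> \<epsilon>" if "n \<in> {n1, n2}" for n
          using small[of n] that n m(2) by (auto simp: L_def)
      qed (rule osc[OF n])
      then show ?thesis using m(1) Kmax[of r] tr by (intro exI[of _ m]) auto
    qed
    have advance: "\<exists>c' ns' b0'. admissible r (Suc t) c' ns' b0' \<and> E (Suc t) c' ns' b0' \<le> E t c ns b0 - \<epsilon>\<^sup>2"
      if adm: "admissible (Suc r) t c ns b0" and E1: "E t c ns b0 \<le> 1"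
        and n: "sc r \<le> n" and big: "\<epsilon> < L t c ns b0 n"
      for t r c ns b0 n
    proof -
      let ?c = "L t c ns b0 n"
      define c' where "c' = c(t := ?c)"
      define ns' where "ns' = ns(t := n)"
      define b0' where "b0' = b0(t := \<lambda>i x. sgn (avg_last e (f i) (u t c ns b0 i) n x))"
      have "u (Suc t) c' ns' b0' i x = u t c ns b0 i x - of_real ?c *
          dual e (\<lambda>x. sgn (avg_last e (f i) (u t c ns b0 i) n x)) (\<lambda>k x. cnj (f i k x)) n x" for i x
      proof -
        have "(\<Sum>s<t. of_real (c' s) * \<sigma> ns' b0' s i x) = (\<Sum>s<t. of_real (c s) * \<sigma> ns b0 s i x)"
          by (intro sum.cong) (auto simp: c'_def ns'_def b0'_def \<sigma>_def)
        then show ?thesis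
          by (simp add: u_def) (simp add: \<sigma>_def c'_def ns'_def b0'_def b_def[abs_def])
      qed
      then have E': "E (Suc t) c' ns' b0' \<le> E t c ns b0 - ?c\<^sup>2"
        unfolding E_def using energy_decrement[OF fam(1) e uC[OF adm] L_def] by simp
      \<comment> \<open>The energy was at most 1 and cannot become negative, so the decrement bounds
        the new coefficient by 1, however large the residual is pointwise.\<close>
      with E_nonneg[of "Suc t" c' ns' b0'] E1 have "?c\<^sup>2 \<le> 1" by linarith
      then have "?c \<le> 1" using power_le_one_iff[of ?c 2] big \<epsilon> by (simp add: abs_square_le_1)
      moreover have "bounded_by 1 (b0' t i)" if i: "i \<in> I" for i
      proof -
        have "bounded_by (1 + real t) (avg_last e (f i) (u t c ns b0 i) n)"
          using i e by (intro bounded_by_avg_last uC[OF adm] f) auto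
        then show ?thesis unfolding b0'_def by (simp add: bounded_by_sgn bounded_byD)
      qed
      ultimately have "admissible r (Suc t) c' ns' b0'"
        using adm n big \<epsilon> unfolding admissible_def
        by (auto simp: c'_def ns'_def b0'_def less_Suc_eq sc_Suc)
      moreover have "\<epsilon>\<^sup>2 \<le> ?c\<^sup>2" using big \<epsilon> by (intro power_mono) auto
      ultimately show ?thesis using E' by fastforce
    qed
    have main: "\<exists>m\<le>Kmax. \<forall>n1\<in>{m..H m}. \<forall>n2\<in>{m..H m}.
       (\<Sum>i\<in>I. w i * (\<integral>x. norm (avg_last e (f i) (f i (Suc e)) n1 x - avg_last e (f i) (f i (Suc e)) n2 x) \<partial>M)) \<le> 3 * \<epsilon>"
      if "t + r = T" "admissible (Suc r) t c ns b0" "E t c ns b0 \<le> real r * \<epsilon>\<^sup>2" "E t c ns b0 \<le> 1" for t r c ns b0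
      using that
    proof (induction r arbitrary: t c ns b0)
      case 0
      \<comment> \<open>The energy bound is now 0; a further \<open>advance\<close> would make the
        energy negative.\<close>
      have "L t c ns b0 n \<le> \<epsilon>" if "sc 0 \<le> n" for n
      proof (rule ccontr)
        assume "\<not> ?thesis"
        then obtain c' ns' b0' where "E (Suc t) c' ns' b0' \<le> E t c ns b0 - \<epsilon>\<^sup>2"
          using advance[OF 0(2,4) \<open>sc 0 \<le> n\<close>] by auto
        with 0(3) E_nonneg[of "Suc t" c' ns' b0'] zero_less_power[OF \<epsilon>, of 2] show False by simp
      qed
      with stop[OF 0(1,2)] show ?case by blast
    next
      case (Suc r)
      show ?case
      proof (cases "\<forall>n\<ge>sc (Suc r). L t c ns b0 n \<le> \<epsilon>")
        case True
        then show ?thesis using stop[OF Suc.prems(1,2)] by blast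
      next
        case False
        then obtain c' ns' b0' where *: "admissible (Suc r) (Suc t) c' ns' b0'"
          "E (Suc t) c' ns' b0' \<le> E t c ns b0 - \<epsilon>\<^sup>2"
          using advance[OF Suc.prems(2,4)] by (metis not_le)
        have "E (Suc t) c' ns' b0' \<le> 1"
          using *(2) Suc.prems(4) zero_le_power2[of \<epsilon>] by linarith
        then show ?thesis
          using Suc.prems * by (intro Suc.IH[OF _ *(1)]) (auto simp: algebra_simps)
      qed
    qed
    \<comment> \<open>For \<open>t = 0\<close> the residual is the last function itself. Its energy
      is at most 1, hence at most \<open>real T * \<epsilon>\<^sup>2\<close>, which starts
      \<open>main\<close> at \<open>r = T\<close>.\<close>
    have "E 0 (\<lambda>_. 0) (\<lambda>_. 0) (\<lambda>_ _ _. 0) \<le> (\<Sum>i\<in>I. w i * 1)"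
      unfolding E_def
    proof (intro sum_mono mult_left_mono w)
      fix i assume "i \<in> I"
      then have "bounded_by 1 (f i (Suc e))" by (intro f) auto
      then have "(norm (f i (Suc e) x))\<^sup>2 \<le> 1" if "x \<in> space M" for x
        using that by (auto simp: bounded_by_def power_le_one)
      then have "(\<integral>x. (norm (u 0 (\<lambda>_. 0) (\<lambda>_. 0) (\<lambda>_ _ _. 0) i x))\<^sup>2 \<partial>M) \<le> (\<integral>x. 1 \<partial>M)"
        by (intro integral_mono') (auto simp: u_def)
      then show "(\<integral>x. (norm (u 0 (\<lambda>_. 0) (\<lambda>_. 0) (\<lambda>_ _ _. 0) i x))\<^sup>2 \<partial>M) \<le> 1"
        by (simp add: prob_space)
    qed
    then have "E 0 (\<lambda>_. 0) (\<lambda>_. 0) (\<lambda>_ _ _. 0) \<le> 1" using w1 by simp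
    from main[OF _ _ _ this, of T] this T(2) show "\<exists>m\<le>Kmax. \<forall>n1\<in>{m..H m}. \<forall>n2\<in>{m..H m}.
       (\<Sum>i\<in>I. w i * (\<integral>x. norm (avg (Suc e) (f i) n1 x - avg (Suc e) (f i) n2 x) \<partial>M)) \<le> \<epsilon>'"
      by (simp add: avg_Suc \<epsilon>_def admissible_def)
  qed
qed

section \<open>From metastability to Cauchy sequences in L^1\<close>

lemma favg_const: "favg n (\<lambda>_. c) = c"
  unfolding favg_def using card_F_pos[of n] by simp

lemma metastable_0: "metastable 0"
  unfolding metastable_def avg_def by (auto simp: favg_const intro!: exI[of _ 0])

lemma metastable: "e \<le> d \<Longrightarrow> metastable e"
  by (induction e) (auto intro: metastable_0 metastable_Suc)

text \<open>If the Cauchy property failed, every \<open>m\<close> would have a bad pair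
  \<open>p m\<close>, \<open>q m\<close> beyond it. Metastability of a one-element family, with
  windows reaching up to the larger of the two, rules this out.\<close>

lemma avg_Cauchy_L1:
  assumes f: "\<And>k. k \<in> {1..d} \<Longrightarrow> bounded_by 1 (f k)" and \<epsilon>: "0 < \<epsilon>"
  shows "\<exists>n0. \<forall>n1\<ge>n0. \<forall>n2\<ge>n0. (\<integral>x. norm (avg d f n1 x - avg d f n2 x) \<partial>M) \<le> \<epsilon>"
proof (rule ccontr)
  assume "\<not> ?thesis"
  then have "\<forall>m. \<exists>n1 n2. n1 \<ge> m \<and> n2 \<ge> m \<and> \<not> (\<integral>x. norm (avg d f n1 x - avg d f n2 x) \<partial>M) \<le> \<epsilon>"
    by blast
  then obtain p q where pq: "\<And>m. p m \<ge> m \<and> q m \<ge> m \<and>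
      \<not> (\<integral>x. norm (avg d f (p m) x - avg d f (q m) x) \<partial>M) \<le> \<epsilon>"
    by metis
  have "unit_family d {[]} (\<lambda>_. 1) (\<lambda>_. f)" using f by (simp add: unit_family_def)
  then obtain m where "\<forall>n1\<in>{m..max (p m) (q m)}. \<forall>n2\<in>{m..max (p m) (q m)}.
      (\<Sum>i\<in>{[] :: ('g \<times> nat) list}. 1 * (\<integral>x. norm (avg d f n1 x - avg d f n2 x) \<partial>M)) \<le> \<epsilon>"
    using metastable[OF order_refl, unfolded metastable_def, THEN spec, THEN mp, OF \<epsilon>, THEN spec,
      of "\<lambda>m. max (p m) (q m)"] by blast
  with pq[of m] show False by auto
qed

end

section \<open>Convergence in L^2 from the L^1 Cauchy property and uniform bounds\<close>

text \<open>An almost everywhere convergent subsequence supplies the limit \<open>v\<close>, which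
  inherits the bound \<open>C\<close>. Since the differences are at most \<open>2 * C\<close>, their
  squares are at most \<open>2 * C\<close> times their norms, so L^1 convergence upgrades to
  L^2.\<close>

lemma (in prob_space) converges_in_L2_if_Cauchy_L1:
  fixes u :: "nat \<Rightarrow> 'a \<Rightarrow> complex"
  assumes meas [measurable]: "\<And>n. u n \<in> borel_measurable M"
    and bound: "\<And>n x. x \<in> space M \<Longrightarrow> norm (u n x) \<le> C"
    and Cauchy: "\<And>\<epsilon>. 0 < \<epsilon> \<Longrightarrow> \<exists>n0. \<forall>n1\<ge>n0. \<forall>n2\<ge>n0. (\<integral>x. norm (u n1 x - u n2 x) \<partial>M) \<le> \<epsilon>"
  shows "converges_in_L2 M u"
proof -
  have int: "integrable M (u n)" for n
    using bound by (intro integrable_const_bound[where B = C]) auto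
  have lt: "\<exists>n0. \<forall>n1\<ge>n0. \<forall>n2\<ge>n0. (\<integral>x. norm (u n1 x - u n2 x) \<partial>M) < \<epsilon>" if "0 < \<epsilon>" for \<epsilon>
  proof -
    obtain n0 where "\<forall>n1\<ge>n0. \<forall>n2\<ge>n0. (\<integral>x. norm (u n1 x - u n2 x) \<partial>M) \<le> \<epsilon> / 2"
      using Cauchy[OF half_gt_zero[OF \<open>0 < \<epsilon>\<close>]] by blast
    moreover have "\<epsilon> / 2 < \<epsilon>" using \<open>0 < \<epsilon>\<close> by simp
    ultimately show ?thesis by (meson order_le_less_trans)
  qed
  obtain r where r: "strict_mono r" "AE x in M. Cauchy (\<lambda>i. u (r i) x)"
    by (rule cauchy_L1_AE_cauchy_subseq[OF int lt])
  define v where "v x = lim (\<lambda>i. u (r i) x)" for x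
  have v [measurable]: "v \<in> borel_measurable M"
    unfolding v_def by (rule borel_measurable_lim_metric) simp
  have lim: "AE x in M. (\<lambda>i. u (r i) x) \<longlonglongrightarrow> v x"
    using r(2) by eventually_elim (simp add: v_def Cauchy_convergent_iff convergent_LIMSEQ_iff)
  have vC: "AE x in M. norm (v x) \<le> C"
    using lim AE_space
  proof eventually_elim
    case (elim x)
    then have "(\<lambda>i. norm (u (r i) x)) \<longlonglongrightarrow> norm (v x)" by (intro tendsto_norm)
    then show ?case by (rule LIMSEQ_le_const2) (use bound elim in auto)
  qed
  have diff: "AE x in M. norm (u n x - v x) \<le> 2 * C" for n
    using vC AE_space
  proof eventually_elim
    case (elim x)
    then show ?case using bound[of x n] norm_triangle_ineq4[of "u n x" "v x"] by simp
  qed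
  have intd: "integrable M (\<lambda>x. norm (u n x - v x))" for n
    using diff by (intro integrable_norm integrable_const_bound[where B = "2 * C"]) auto
  have L1: "(\<lambda>n. \<integral>x. norm (u n x - v x) \<partial>M) \<longlonglongrightarrow> 0"
  proof (rule LIMSEQ_I)
    fix \<epsilon> :: real assume "0 < \<epsilon>"
    then obtain n0 where n0: "\<And>n1 n2. n0 \<le> n1 \<Longrightarrow> n0 \<le> n2 \<Longrightarrow> (\<integral>x. norm (u n1 x - u n2 x) \<partial>M) \<le> \<epsilon> / 2"
      using Cauchy[OF half_gt_zero] by blast
    have "norm ((\<integral>x. norm (u n x - v x) \<partial>M) - 0) < \<epsilon>" if n: "n0 \<le> n" for n
    proof -
      \<comment> \<open>Letting the second index run along the subsequence carries the Cauchy bound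
        over to \<open>v\<close>, and so gives convergence of the whole sequence.\<close>
      have "(\<lambda>i. \<integral>x. norm (u n x - u (r i) x) \<partial>M) \<longlonglongrightarrow> (\<integral>x. norm (u n x - v x) \<partial>M)"
      proof (rule integral_dominated_convergence[where w = "\<lambda>_. 2 * C"])
        show "AE x in M. (\<lambda>i. norm (u n x - u (r i) x)) \<longlonglongrightarrow> norm (u n x - v x)"
          using lim by eventually_elim (intro tendsto_intros)
        show "AE x in M. norm (norm (u n x - u (r i) x)) \<le> 2 * C" for i
          using AE_space
        proof eventually_elim
          case (elim x)
          then show ?case using bound[of x n] bound[of x "r i"] norm_triangle_ineq4[of "u n x" "u (r i) x"] by simp
        qed
      qed auto
      moreover have "\<exists>N. \<forall>i\<ge>N. (\<integral>x. norm (u n x - u (r i) x) \<partial>M) \<le> \<epsilon> / 2"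
        using n0[OF n] seq_suble[OF r(1)] by (meson order_trans)
      ultimately have "(\<integral>x. norm (u n x - v x) \<partial>M) \<le> \<epsilon> / 2" by (rule LIMSEQ_le_const2)
      then show ?thesis using \<open>0 < \<epsilon>\<close> by (simp add: abs_of_nonneg integral_nonneg_AE)
    qed
    then show "\<exists>no. \<forall>n\<ge>no. norm ((\<integral>x. norm (u n x - v x) \<partial>M) - 0) < \<epsilon>" by blast
  qed
  have L2int: "integrable M (\<lambda>x. (norm (h x))\<^sup>2)"
    if "h \<in> borel_measurable M" "AE x in M. norm (h x) \<le> B" for h :: "'a \<Rightarrow> complex" and B
    using that by (intro integrable_const_bound[where B = "B\<^sup>2"]) (auto elim!: eventually_mono intro!: power_mono)
  have "(\<lambda>n. \<integral>x. (norm (u n x - v x))\<^sup>2 \<partial>M) \<longlonglongrightarrow> 0"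
  proof (rule tendsto_sandwich[of "\<lambda>_. 0" _ _ "\<lambda>n. 2 * C * (\<integral>x. norm (u n x - v x) \<partial>M)"])
    show "(\<lambda>n. 2 * C * (\<integral>x. norm (u n x - v x) \<partial>M)) \<longlonglongrightarrow> 0"
      using tendsto_mult_right_zero[OF L1] by simp
    have "(\<integral>x. (norm (u n x - v x))\<^sup>2 \<partial>M) \<le> (\<integral>x. 2 * C * norm (u n x - v x) \<partial>M)" for n
    proof (rule integral_mono_AE)
      show "integrable M (\<lambda>x. (norm (u n x - v x))\<^sup>2)" by (rule L2int[OF _ diff]) simp
      show "AE x in M. (norm (u n x - v x))\<^sup>2 \<le> 2 * C * norm (u n x - v x)"
        using diff[of n] by eventually_elim (simp add: power2_eq_square mult_right_mono)
    qed (use intd in simp)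
    then show "\<forall>\<^sub>F n in sequentially. (\<integral>x. (norm (u n x - v x))\<^sup>2 \<partial>M) \<le> 2 * C * (\<integral>x. norm (u n x - v x) \<partial>M)"
      by simp
  qed auto
  then have "(\<lambda>n. L2_norm M (\<lambda>x. u n x - v x)) \<longlonglongrightarrow> 0"
    unfolding L2_norm_def using tendsto_real_sqrt by fastforce
  moreover have "v \<in> L2_space M" unfolding L2_space_def using L2int[OF v vC] by simp
  moreover have "u n \<in> L2_space M" for n unfolding L2_space_def using L2int[OF meas, of n C] bound by simp
  ultimately show ?thesis unfolding converges_in_L2_def by blast
qed

text \<open>This transfers convergence from averages of normalised, truncated functions back to
  those of the original ones, which differ by a constant factor and a null set.\<close>

lemma converges_in_L2_cmult_AE:
  assumes u: "converges_in_L2 M u" and w [measurable]: "\<And>n. w n \<in> borel_measurable M"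
    and eq: "\<And>n. AE x in M. w n x = c * u n x"
  shows "converges_in_L2 M w"
proof -
  have u2: "u n \<in> L2_space M" for n using u by (simp add: converges_in_L2_def)
  obtain v where v: "v \<in> L2_space M" and lim: "(\<lambda>n. L2_norm M (\<lambda>x. u n x - v x)) \<longlonglongrightarrow> 0"
    using u by (auto simp: converges_in_L2_def)
  have [measurable]: "u n \<in> borel_measurable M" "v \<in> borel_measurable M" for n
    using u2 v by (auto simp: L2_space_def)
  have scale: "(\<lambda>x. c * h x) \<in> L2_space M" if "h \<in> L2_space M" for h
    using that by (auto simp: L2_space_def norm_mult power_mult_distrib)
  have "w n \<in> L2_space M" for n
  proof -
    have "AE x in M. (norm (c * u n x))\<^sup>2 = (norm (w n x))\<^sup>2" using eq[of n] by eventually_elim simp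
    then have "integrable M (\<lambda>x. (norm (w n x))\<^sup>2)"
      using scale[OF u2[of n]] by (subst integrable_cong_AE[symmetric]) (auto simp: L2_space_def)
    then show ?thesis by (simp add: L2_space_def)
  qed
  moreover have "L2_norm M (\<lambda>x. w n x - c * v x) = norm c * L2_norm M (\<lambda>x. u n x - v x)" for n
  proof -
    have "(\<integral>x. (norm (w n x - c * v x))\<^sup>2 \<partial>M) = (\<integral>x. (norm c)\<^sup>2 * (norm (u n x - v x))\<^sup>2 \<partial>M)"
    proof (rule integral_cong_AE)
      show "AE x in M. (norm (w n x - c * v x))\<^sup>2 = (norm c)\<^sup>2 * (norm (u n x - v x))\<^sup>2"
        using eq[of n] by eventually_elim (simp flip: right_diff_distrib power_mult_distrib norm_mult)
    qed auto
    then show ?thesis by (simp add: L2_norm_def real_sqrt_mult)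
  qed
  ultimately show ?thesis
    unfolding converges_in_L2_def using tendsto_mult_right_zero[OF lim, of "norm c"]
    by (intro conjI allI bexI[OF _ scale[OF v]]) simp_all
qed

section \<open>Partial products of commuting measure-preserving actions\<close>

lemma
  assumes "mp_action G M T" "group G"
  shows mp_action_measurable: "g \<in> carrier G \<Longrightarrow> T g \<in> measurable M M"
    and mp_action_distr: "g \<in> carrier G \<Longrightarrow> distr M M (T g) = M"
    and mp_action_space: "\<lbrakk>g \<in> carrier G; x \<in> space M\<rbrakk> \<Longrightarrow> T g x \<in> space M"
    and mp_action_mult: "\<lbrakk>g \<in> carrier G; h \<in> carrier G; x \<in> space M\<rbrakk> \<Longrightarrow> T (g \<otimes>\<^bsub>G\<^esub> h) x = T g (T h x)"
    and mp_action_one: "x \<in> space M \<Longrightarrow> T \<one>\<^bsub>G\<^esub> x = x"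
proof -
  interpret group_action G "space M" T using assms(1) by (simp add: mp_action_def)
  show meas: "g \<in> carrier G \<Longrightarrow> T g \<in> measurable M M"
    and "g \<in> carrier G \<Longrightarrow> distr M M (T g) = M"
    using assms(1) by (auto simp: mp_action_def)
  show "\<lbrakk>g \<in> carrier G; x \<in> space M\<rbrakk> \<Longrightarrow> T g x \<in> space M"
    using meas by (rule measurable_space)
  show "\<lbrakk>g \<in> carrier G; h \<in> carrier G; x \<in> space M\<rbrakk> \<Longrightarrow> T (g \<otimes>\<^bsub>G\<^esub> h) x = T g (T h x)"
    by (rule composition_rule)
  show "x \<in> space M \<Longrightarrow> T \<one>\<^bsub>G\<^esub> x = x"
    using id_eq_one by (metis restrict_apply')
qed

locale commuting_mp_actions = prob_space M + group G
  for M :: "'a measure" and G :: "('g, 'r) monoid_scheme" (structure) +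
  fixes T :: "nat \<Rightarrow> 'g \<Rightarrow> 'a \<Rightarrow> 'a" and d :: nat
  assumes mp: "i \<in> {1..d} \<Longrightarrow> mp_action G M (T i)"
    and commuting: "commuting_actions G M d T"
begin

lemma comp_upto_measurable: "\<lbrakk>k \<le> d; g \<in> carrier G\<rbrakk> \<Longrightarrow> comp_upto T g k \<in> measurable M M"
  by (induction k) (auto intro!: measurable_comp mp_action_measurable[OF mp] is_group)

lemma comp_upto_space: "\<lbrakk>k \<le> d; g \<in> carrier G; x \<in> space M\<rbrakk> \<Longrightarrow> comp_upto T g k x \<in> space M"
  using comp_upto_measurable measurable_space by metis

lemma T_space: "\<lbrakk>k \<in> {1..d}; g \<in> carrier G; x \<in> space M\<rbrakk> \<Longrightarrow> T k g x \<in> space M"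
  by (rule mp_action_space[OF mp is_group])

lemma comp_upto_distr: "\<lbrakk>k \<le> d; g \<in> carrier G\<rbrakk> \<Longrightarrow> distr M M (comp_upto T g k) = M"
proof (induction k)
  case 0
  then show ?case by (simp add: id_def distr_id)
next
  case (Suc k)
  have "distr M M (comp_upto T g (Suc k)) = distr (distr M M (T (Suc k) g)) M (comp_upto T g k)"
    using Suc.prems by (subst distr_distr) (auto intro!: comp_upto_measurable mp_action_measurable[OF mp] is_group)
  also have "\<dots> = M" using Suc by (simp add: mp_action_distr[OF mp is_group])
  finally show ?case .
qed

lemma T_comp_upto_commute:
  "\<lbrakk>k < j; j \<le> d; g \<in> carrier G; h \<in> carrier G; x \<in> space M\<rbrakk>
    \<Longrightarrow> T j h (comp_upto T g k x) = comp_upto T g k (T j h x)"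
proof (induction k arbitrary: x)
  case (Suc k)
  have "T j h (T (Suc k) g x) = T (Suc k) g (T j h x)"
    using commuting Suc.prems by (auto simp: commuting_actions_def)
  with Suc T_space[of "Suc k" g x] show ?case by simp
qed simp

text \<open>This is where commutation makes the product of actions an action:
  \<open>T (Suc k) g\<close> has to be moved past \<open>comp_upto T h k\<close>.\<close>

lemma comp_upto_mult:
  "\<lbrakk>k \<le> d; g \<in> carrier G; h \<in> carrier G; x \<in> space M\<rbrakk>
    \<Longrightarrow> comp_upto T (g \<otimes> h) k x = comp_upto T g k (comp_upto T h k x)"
proof (induction k arbitrary: x)
  case (Suc k)
  then show ?case
    using T_space[of "Suc k" h x] T_space[of "Suc k" g "T (Suc k) h x"]
    by (simp add: mp_action_mult[OF mp is_group] T_comp_upto_commute)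
qed simp

lemma comp_upto_one: "\<lbrakk>k \<le> d; x \<in> space M\<rbrakk> \<Longrightarrow> comp_upto T \<one> k x = x"
  by (induction k) (simp_all add: mp_action_one[OF mp is_group])

text \<open>For \<open>k = i\<close> the inner composite is the identity. Each further step up to
  \<open>k\<close> inserts one action of index above \<open>i\<close>, which commutes with
  \<open>comp_upto T l i\<close>.\<close>

lemma comp_upto_commute:
  assumes i: "i \<le> k" and "k \<le> d" "l \<in> carrier G" "m \<in> carrier G" "x \<in> space M"
  shows "comp_upto T l i (comp_upto T m i (comp_upto T (inv m) k x)) =
    comp_upto T m i (comp_upto T (inv m) k (comp_upto T l i x))"
  using assms
proof (induction k arbitrary: x rule: dec_induct)
  case base
  have "comp_upto T m i (comp_upto T (inv m) i y) = y" if "y \<in> space M" for y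
    using comp_upto_mult[of i m "inv m" y] comp_upto_one[of i y] base that by simp
  with base comp_upto_space[of i l x] show ?case by simp
next
  case (step k)
  then show ?case
    using T_space[of "Suc k" "inv m" x] by (simp add: T_comp_upto_commute)
qed

end

section \<open>Convergence of the functional averages\<close>

theorem theoremA:
  fixes G :: "('g, 'r) monoid_scheme"
    and M :: "'a measure"
    and F :: "nat \<Rightarrow> 'g set"
    and d :: nat
    and T :: "nat \<Rightarrow> 'g \<Rightarrow> 'a \<Rightarrow> 'a"
  assumes "prob_space M"
    and "group G"
    and "countable (carrier G)"
    and "amenable G"
    and "left_Folner_sequence G F"
    and "d \<ge> 1"
    and "\<And>i. i \<in> {1..d} \<Longrightarrow> mp_action G M (T i)"
    and "commuting_actions G M d T"
  shows "\<forall>f :: nat \<Rightarrow> 'a \<Rightarrow> complex.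
           (\<forall>i\<in>{1..d}. f i \<in> Linf_space M) \<longrightarrow>
           converges_in_L2 M (functional_average F d T f)"
proof (intro allI impI)
  fix f :: "nat \<Rightarrow> 'a \<Rightarrow> complex"
  assume f: "\<forall>i\<in>{1..d}. f i \<in> Linf_space M"
  interpret prob_space M by fact
  interpret group G by fact
  interpret A: commuting_mp_actions M G T d
    by unfold_locales (use assms in auto)
  interpret A: action_tower M G F "\<lambda>k g. comp_upto T g k" d
    by unfold_locales
      (use assms in \<open>auto intro: A.comp_upto_measurable A.comp_upto_distr A.comp_upto_mult
        A.comp_upto_one A.comp_upto_commute\<close>)
  have fm [measurable]: "f i \<in> borel_measurable M" if "i \<in> {1..d}" for i
    using f that by (auto simp: Linf_space_def)
  have "\<forall>i\<in>{1..d}. \<exists>C::real. AE x in M. norm (f i x) \<le> C"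
    using f by (auto simp: Linf_space_def)
  then obtain C :: "nat \<Rightarrow> real" where C: "\<And>i. i \<in> {1..d} \<Longrightarrow> AE x in M. norm (f i x) \<le> C i"
    by metis
  \<comment> \<open>The maximum with 1 keeps the divisor positive even if \<open>C i\<close> is 0.
    Cutting off to 0 where the bound fails makes \<open>h i\<close> bounded by 1 everywhere, at the
    price of changing it on a null set only.\<close>
  define D where "D i = max 1 (C i)" for i
  define h where "h i x = (if norm (f i x) \<le> D i then f i x / of_real (D i) else 0)" for i x
  have D: "0 < D i" for i by (simp add: D_def)
  have h: "A.bounded_by 1 (h i)" if "i \<in> {1..d}" for i
    unfolding A.bounded_by_def h_def using fm[OF that] D[of i]
    by (auto simp: norm_divide divide_le_eq)
  have fh: "AE x in M. f i x = of_real (D i) * h i x" if "i \<in> {1..d}" for i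
    using C[OF that] by eventually_elim (use D[of i] in \<open>auto simp: h_def D_def\<close>)
  have avg: "functional_average F d T h = A.avg d h"
    by (intro ext) (simp add: functional_average_def A.avg_def A.favg_def)
  have "converges_in_L2 M (A.avg d h)"
  proof (rule converges_in_L2_if_Cauchy_L1)
    have "A.bounded_by 1 (A.avg d h n)" for n by (rule A.bounded_by_avg[OF order_refl h])
    then show "A.avg d h n \<in> borel_measurable M" "x \<in> space M \<Longrightarrow> norm (A.avg d h n x) \<le> 1" for n x
      by (auto simp: A.bounded_by_def)
    show "\<exists>n0. \<forall>n1\<ge>n0. \<forall>n2\<ge>n0. (\<integral>x. norm (A.avg d h n1 x - A.avg d h n2 x) \<partial>M) \<le> \<epsilon>"
      if "0 < \<epsilon>" for \<epsilon>
      by (rule A.avg_Cauchy_L1[OF h that])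
  qed
  then show "converges_in_L2 M (functional_average F d T f)"
    unfolding avg[symmetric]
  proof (rule converges_in_L2_cmult_AE)
    fix n
    have "(\<lambda>x. f i (comp_upto T g i x)) \<in> borel_measurable M" if "g \<in> F n" "i \<in> {1..d}" for g i
      using that by (intro measurable_compose[OF A.S_measurable fm]) (auto simp: A.F_carrier)
    then show "functional_average F d T f n \<in> borel_measurable M"
      unfolding functional_average_def[abs_def] comp_apply
      by (intro borel_measurable_times borel_measurable_sum borel_measurable_prod) auto
    \<comment> \<open>The partial products preserve the measure, so the exceptional null set pulls
      back to a null set; only finitely many \<open>g\<close> and \<open>i\<close> occur, so a
      single null set suffices for each \<open>n\<close>.\<close>
    have "AE x in M. f i (comp_upto T g i x) = of_real (D i) * h i (comp_upto T g i x)"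
      if g: "g \<in> F n" and i: "i \<in> {1..d}" for g i
    proof (rule AE_distrD[where M' = M])
      show "comp_upto T g i \<in> measurable M M" using A.S_measurable[OF i] A.F_carrier[OF g] by blast
      show "AE x in distr M M (comp_upto T g i). f i x = of_real (D i) * h i x"
        unfolding A.S_distr[OF i A.F_carrier[OF g]] by (rule fh[OF i])
    qed
    then have "AE x in M. \<forall>g\<in>F n. \<forall>i\<in>{1..d}. f i (comp_upto T g i x) = of_real (D i) * h i (comp_upto T g i x)"
      by (simp add: AE_finite_all)
    then show "AE x in M. functional_average F d T f n x =
        (\<Prod>i=1..d. of_real (D i)) * functional_average F d T h n x"
    proof eventually_elim
      case (elim x)
      then have "(\<Sum>g\<in>F n. \<Prod>i=1..d. (f i \<circ> comp_upto T g i) x) =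
          (\<Sum>g\<in>F n. \<Prod>i=1..d. of_real (D i) * (h i \<circ> comp_upto T g i) x)"
        by (intro sum.cong prod.cong) auto
      then show ?case
        unfolding functional_average_def by (simp add: prod.distrib sum_distrib_left[symmetric])
    qed
  qed
qed

end
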